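(* Let $\{p(x,y)\}_{x,y\in V}$ be the transition probabilities of an irreducible Markov chain on a countable state space $V$ with stationary distribution $\pi$. Suppose that $0<\gamma\le\frac12$ and $p(x,x)\ge\gamma$ for all $x\in V$. Let $\epsilon>0$ and $x,y\in V$. If the integer $n\ge 0$ satisfies $$n\ge 1+\frac{(1-\gamma)^2}{\gamma^2}\int_{4(\pi(x)\wedge\pi(y))}^{4/\epsilon}\frac{4\,du}{u\,\Phi^2(u)},$$ then $$\left|\frac{p^n(x,y)-\pi(y)}{\pi(y)}\right|\le\epsilon.$$
   Context: Here $\pi$ is a probability distribution on $V$ with $\sum_{x\in V}\pi(x)p(x,y)=\pi(y)$ for all $y$; reversibility is not assumed. $p^n(x,y)$ denotes the $n$-step transition probability and $\alpha\wedge\beta=\min\{\alpha,\beta\}$. For $x,y\in V$ let $Q(x,y)=\pi(x)p(x,y)$, and for $S,A\subset V$ let $Q(S,A)=\sum_{s\in S,a\in A}Q(s,a)$. For nonempty $S\subset V$ the conductance of $S$ is $\Phi_S=Q(S,S^c)/\pi(S)$. The conductance profile is $\Phi(r)=\inf\{\Phi_S:\ \emptyset\ne S\subset V,\ \pi(S)\le r\}$ for $0<r\le 1/2$, and $\Phi(r)=\Phi(1/2)$ for $r>1/2$ (with $\inf\emptyset=+\infty$, $1/\infty=0$, $1/0=+\infty$). *)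

theory Defs
  imports "HOL-Probability.Probability"
begin

text \<open>
  The state space \<open>V\<close> is the universe of a countable type \<open>'a\<close>, the transition probabilities are
  \<open>p(x,y) = pmf (P x) y\<close>, and \<open>\<pi>(x)\<close> is \<open>pmf \<pi> x\<close>.
\<close>

primrec nstep :: "('a \<Rightarrow> 'a pmf) \<Rightarrow> nat \<Rightarrow> 'a \<Rightarrow> 'a pmf" where
  "nstep P 0 x = return_pmf x"
| "nstep P (Suc n) x = bind_pmf (P x) (nstep P n)"

definition irreducible_chain :: "('a \<Rightarrow> 'a pmf) \<Rightarrow> bool" where
  "irreducible_chain P \<longleftrightarrow> (\<forall>x y. \<exists>n. pmf (nstep P n x) y > 0)"

definition stationary :: "('a \<Rightarrow> 'a pmf) \<Rightarrow> 'a pmf \<Rightarrow> bool" where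
  "stationary P \<pi> \<longleftrightarrow> (\<forall>y. ((\<lambda>x. pmf \<pi> x * pmf (P x) y) has_sum pmf \<pi> y) UNIV)"

definition flow :: "('a \<Rightarrow> 'a pmf) \<Rightarrow> 'a pmf \<Rightarrow> 'a set \<Rightarrow> 'a set \<Rightarrow> real" where
  "flow P \<pi> S A = (\<Sum>\<^sub>\<infinity>(s, a)\<in>S \<times> A. pmf \<pi> s * pmf (P s) a)"

definition conductance :: "('a \<Rightarrow> 'a pmf) \<Rightarrow> 'a pmf \<Rightarrow> 'a set \<Rightarrow> real" where
  "conductance P \<pi> S = flow P \<pi> S (- S) / measure_pmf.prob \<pi> S"

text \<open>
  The profile takes values in \<^typ>\<open>ennreal\<close>, so that the infimum of the empty set is \<open>\<infinity>\<close>
  (while \<open>1 / \<infinity> = 0\<close> and \<open>1 / 0 = \<infinity>\<close>). Only its values at \<open>r > 0\<close> are meaningful.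
\<close>

definition conductance_profile :: "('a \<Rightarrow> 'a pmf) \<Rightarrow> 'a pmf \<Rightarrow> real \<Rightarrow> ennreal" where
  "conductance_profile P \<pi> r =
     (let r' = (if r \<le> 1/2 then r else 1/2)
      in INF S \<in> {S. S \<noteq> {} \<and> measure_pmf.prob \<pi> S \<le> r'}. ennreal (conductance P \<pi> S))"

text \<open>
  The integral of a nonnegative function from \<open>a\<close> to \<open>b\<close>, with value \<open>\<infinity>\<close> if it diverges and with the
  usual sign convention if \<open>b < a\<close>. The library's interval integrals are unsuitable here, since they
  assign the value \<open>0\<close> to a divergent integral.
\<close>

definition oriented_integral :: "real \<Rightarrow> real \<Rightarrow> (real \<Rightarrow> ennreal) \<Rightarrow> ereal" where
  "oriented_integral a b f =
     (if a \<le> b then enn2ereal (\<integral>\<^sup>+u\<in>{a..b}. f u \<partial>lborel)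
      else - enn2ereal (\<integral>\<^sup>+u\<in>{b..a}. f u \<partial>lborel))"

end

theory Submission
  imports Defs
begin

text \<open>
  The proof is an \<open>L\<^sup>2\<close> argument in the manner of the spectral profile.

  Fix a target \<open>z\<close> and let \<open>g\<^sub>n(y) = p\<^sup>n(y,z)/\<pi>(z)\<close>, a bounded function of \<open>\<pi>\<close>-mean \<open>1\<close> with
  \<open>g\<^sub>n\<^sub>+\<^sub>1 = P g\<^sub>n\<close>. Its variance \<open>V\<^sub>n\<close> under \<open>\<pi>\<close> is the chi-square distance to stationarity. Averaging
  over a step that stays put with probability at least \<open>\<gamma>\<close> destroys variance: with
  \<open>D(g) = \<Sum> Q(x,y) (g(x) - g(y))\<^sup>2\<close> one has \<open>V\<^sub>n - V\<^sub>n\<^sub>+\<^sub>1 \<ge> \<gamma> D(g\<^sub>n)\<close> (\<open>variance_decay\<close>).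

  The energy \<open>D\<close> is bounded below through the conductance profile. If \<open>f \<ge> 0\<close> lives on a set of
  measure at most \<open>r \<le> 1/2\<close>, then integrating over the level sets of \<open>f\<^sup>2\<close> and applying Cauchy-Schwarz
  to the off-diagonal edges only gives \<open>\<Phi>(r)\<^sup>2 \<parallel>f\<parallel>\<^sup>2 \<le> (1 - \<gamma>) D(f)\<close> (\<open>Cheeger_inequality\<close>). The factor
  \<open>1 - \<gamma>\<close>, the mass off the diagonal, is what makes the constant small enough. For a
  nonnegative \<open>g\<close> with mean \<open>1\<close> and variance \<open>V\<close>, the truncation \<open>(g - V/4)\<^sup>+\<close> has squared norm at least \<open>V/2\<close>,
  and by Markov's inequality it lives on a set of measure at most \<open>4/V\<close>; when \<open>4/V > 1/2\<close> one splits \<open>g\<close> at a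
  median instead (\<open>energy_lower_bound\<close>). Altogether
  \<open>V\<^sub>n\<^sub>+\<^sub>1 \<le> V\<^sub>n (1 - \<gamma>/(2(1 - \<gamma>)) \<Phi>(4/V\<^sub>n)\<^sup>2)\<close>.

  This recursion is compared with the integral in the substitution \<open>u = 4/V\<close>: each step contributes at
  least \<open>2\<gamma>/(1 - \<gamma>)\<close> to the integral of \<open>4/(u \<Phi>\<^sup>2(u))\<close> (\<open>decay_by_integral\<close>). Since
  \<open>(1 - \<gamma>)/\<gamma> \<le> (1 - \<gamma>)\<^sup>2/\<gamma>\<^sup>2\<close>, half of the \<open>n\<close> steps granted by the hypothesis bring the chi-square distance
  below \<open>\<epsilon>\<close>.

  Finally \<open>p\<^sup>k\<^sup>+\<^sup>l(x,y)/\<pi>(y) - 1\<close> is the inner product in \<open>L\<^sup>2(\<pi>)\<close> of \<open>p\<^sup>k(x,\<cdot>)/\<pi> - 1\<close> and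
  \<open>p\<^sup>l(\<cdot>,y)/\<pi>(y) - 1\<close>. The first function belongs to the time-reversed chain, which has the same
  conductances and the same holding probabilities, so both factors have norm at most \<open>\<surd>\<epsilon>\<close>
  (\<open>relative_error_le_chi_square\<close>).
\<close>

section \<open>Expectations of bounded functions\<close>

text \<open>
  Every function to which expectations are applied below is bounded: the densities
  \<open>p\<^sup>n(\<cdot>,z)/\<pi>(z)\<close> are at most \<open>1/\<pi>(z)\<close>. Integrability thus reduces to closure properties of
  \<open>bounded (range f)\<close>.
\<close>

lemma bounded_range_compose:
  fixes f :: "'b \<Rightarrow> real"
  shows "bounded (range f) \<Longrightarrow> bounded (range (\<lambda>x. f (h x)))"
  by (rule bounded_subset) auto

lemma bounded_rangeI:
  fixes f :: "'b \<Rightarrow> real"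
  assumes "\<And>x. \<bar>f x\<bar> \<le> B"
  shows "bounded (range f)"
  using assms by (auto intro!: boundedI)

lemma bounded_rangeD:
  fixes f :: "'b \<Rightarrow> real"
  assumes "bounded (range f)"
  shows "\<exists>B>0. \<forall>x. \<bar>f x\<bar> \<le> B"
  using assms by (auto simp: bounded_pos)

lemma bounded_range_add:
  fixes f g :: "'b \<Rightarrow> real"
  assumes "bounded (range f)" "bounded (range g)"
  shows "bounded (range (\<lambda>x. f x + g x))"
  using assms by (rule bounded_plus_comp)

lemma bounded_range_diff:
  fixes f g :: "'b \<Rightarrow> real"
  assumes "bounded (range f)" "bounded (range g)"
  shows "bounded (range (\<lambda>x. f x - g x))"
  using assms by (rule bounded_minus_comp)

lemma bounded_range_mult:
  fixes f g :: "'b \<Rightarrow> real"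
  assumes "bounded (range f)" "bounded (range g)"
  shows "bounded (range (\<lambda>x. f x * g x))"
proof -
  obtain A where A: "A > 0" "\<And>x. \<bar>f x\<bar> \<le> A" using bounded_rangeD[OF assms(1)] by blast
  obtain B where B: "B > 0" "\<And>x. \<bar>g x\<bar> \<le> B" using bounded_rangeD[OF assms(2)] by blast
  have "\<bar>f x * g x\<bar> \<le> A * B" for x
    unfolding abs_mult using A B by (intro mult_mono) (auto simp: less_imp_le)
  then show ?thesis by (rule bounded_rangeI)
qed

lemma bounded_range_power2:
  fixes f :: "'b \<Rightarrow> real"
  shows "bounded (range f) \<Longrightarrow> bounded (range (\<lambda>x. (f x)\<^sup>2))"
  unfolding power2_eq_square by (intro bounded_range_mult)

lemma bounded_range_const: "bounded (range (\<lambda>x::'b. c::real))"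
  by simp

lemma bounded_range_abs:
  fixes f :: "'b \<Rightarrow> real"
  shows "bounded (range f) \<Longrightarrow> bounded (range (\<lambda>x. \<bar>f x\<bar>))"
  by (simp add: bounded_iff)

lemma bounded_range_max:
  fixes f g :: "'b \<Rightarrow> real"
  assumes "bounded (range f)" "bounded (range g)"
  shows "bounded (range (\<lambda>x. max (f x) (g x)))"
proof -
  obtain A where A: "A > 0" "\<And>x. \<bar>f x\<bar> \<le> A" using bounded_rangeD[OF assms(1)] by blast
  obtain B where B: "B > 0" "\<And>x. \<bar>g x\<bar> \<le> B" using bounded_rangeD[OF assms(2)] by blast
  have "\<bar>max (f x) (g x)\<bar> \<le> A + B" for x
    using A(1) A(2)[of x] B(1) B(2)[of x] by linarith
  then show ?thesis by (rule bounded_rangeI)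
qed

lemma bounded_range_of_bool: "bounded (range (\<lambda>x. of_bool (Q x) :: real))"
  by (rule bounded_rangeI[of _ 1]) simp

lemmas bounded_intros =
  bounded_range_const bounded_range_of_bool bounded_range_add bounded_range_diff
  bounded_range_mult bounded_range_power2 bounded_range_abs bounded_range_max

lemma integrable_pmf_bounded:
  fixes f :: "'b \<Rightarrow> real"
  assumes "bounded (range f)"
  shows "integrable (measure_pmf p) f"
proof -
  obtain B where "\<And>x. \<bar>f x\<bar> \<le> B" using bounded_rangeD[OF assms] by blast
  then show ?thesis
    by (intro measure_pmf.integrable_const_bound[where B = B]) auto
qed

lemmas integrable_intros = integrable_pmf_bounded bounded_intros

lemma expectation_nonneg_bind_pmf:
  fixes f :: "'b \<Rightarrow> real"
  assumes bdd: "bounded (range f)" and nonneg: "\<And>x. f x \<ge> 0"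
  shows "measure_pmf.expectation (bind_pmf p K) f
    = measure_pmf.expectation p (\<lambda>x. measure_pmf.expectation (K x) f)"
proof -
  obtain B where B: "\<And>x. \<bar>f x\<bar> \<le> B" using bounded_rangeD[OF bdd] by blast
  have inner: "(\<integral>\<^sup>+y. ennreal (f y) \<partial>measure_pmf q) = ennreal (measure_pmf.expectation q f)" for q
    by (intro nn_integral_eq_integral integrable_pmf_bounded bdd) (auto simp: nonneg)
  have le: "measure_pmf.expectation q f \<le> B" for q
  proof -
    have "measure_pmf.expectation q f \<le> measure_pmf.expectation q (\<lambda>_. B)"
      using B by (intro integral_mono integrable_pmf_bounded bdd) (auto simp: abs_le_iff)
    then show ?thesis by simp
  qed
  have ge: "measure_pmf.expectation q f \<ge> 0" for q
    using nonneg by simp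
  have "ennreal (measure_pmf.expectation (bind_pmf p K) f)
      = (\<integral>\<^sup>+x. ennreal (measure_pmf.expectation (K x) f) \<partial>measure_pmf p)"
    by (simp flip: inner)
  also have "\<dots> = ennreal (measure_pmf.expectation p (\<lambda>x. measure_pmf.expectation (K x) f))"
    using ge le by (intro nn_integral_eq_integral integrable_pmf_bounded bounded_rangeI[of _ B]) auto
  finally show ?thesis
    using ge by (subst (asm) ennreal_inj) auto
qed

lemma bounded_expectation:
  fixes f :: "'b \<Rightarrow> 'c \<Rightarrow> real"
  assumes "\<And>x y. \<bar>f x y\<bar> \<le> B"
  shows "bounded (range (\<lambda>x. measure_pmf.expectation (K x) (f x)))"
proof (rule bounded_rangeI)
  fix x
  have int: "integrable (measure_pmf (K x)) (f x)"
    using assms by (intro integrable_pmf_bounded bounded_rangeI[of _ B])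
  have "measure_pmf.expectation (K x) (\<lambda>y. \<bar>f x y\<bar>) \<le> measure_pmf.expectation (K x) (\<lambda>y. B)"
    using int assms by (intro integral_mono integrable_abs) auto
  also have "\<dots> = B" by simp
  finally show "\<bar>measure_pmf.expectation (K x) (f x)\<bar> \<le> B"
    using integral_abs_bound by (rule order_trans[rotated])
qed

lemma pmf_Cauchy_Schwarz:
  fixes f g :: "'b \<Rightarrow> real"
  assumes [intro]: "bounded (range f)" "bounded (range g)"
  shows "(measure_pmf.expectation p (\<lambda>x. f x * g x))\<^sup>2
    \<le> measure_pmf.expectation p (\<lambda>x. (f x)\<^sup>2) * measure_pmf.expectation p (\<lambda>x. (g x)\<^sup>2)"
proof -
  define a b c where "a = measure_pmf.expectation p (\<lambda>x. (f x)\<^sup>2)"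
    and "b = measure_pmf.expectation p (\<lambda>x. f x * g x)"
    and "c = measure_pmf.expectation p (\<lambda>x. (g x)\<^sup>2)"
  have quad: "0 \<le> a - 2 * t * b + t\<^sup>2 * c" for t
  proof -
    have "0 \<le> measure_pmf.expectation p (\<lambda>x. (f x - t * g x)\<^sup>2)"
      by simp
    also have "(\<lambda>x. (f x - t * g x)\<^sup>2) = (\<lambda>x. (f x)\<^sup>2 - 2 * t * (f x * g x) + t\<^sup>2 * (g x)\<^sup>2)"
      by (auto simp: power2_eq_square algebra_simps)
    also have "measure_pmf.expectation p \<dots> = a - 2 * t * b + t\<^sup>2 * c"
      unfolding a_def b_def c_def
      by (subst Bochner_Integration.integral_add Bochner_Integration.integral_diff
            Bochner_Integration.integral_mult_right_zero;
          (intro integrable_intros assms)?)+ simp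
    finally show ?thesis .
  qed
  have "c \<ge> 0" by (simp add: c_def)
  show ?thesis
  proof (cases "c = 0")
    case True
    have "b = 0"
    proof (rule ccontr)
      assume "b \<noteq> 0"
      with quad[of "(a + 1) / (2 * b)"] True show False by (simp add: field_simps)
    qed
    with True show ?thesis unfolding a_def b_def c_def by simp
  next
    case False
    with \<open>c \<ge> 0\<close> have "c > 0" by simp
    then have "b\<^sup>2 \<le> a * c"
      using quad[of "b / c"] by (simp add: field_simps power2_eq_square)
    then show ?thesis unfolding a_def b_def c_def .
  qed
qed

text \<open>
  An atom at \<open>y\<close> forces \<open>f\<close> to have a variance comparable to its mean square deviation from
  \<open>f(y)\<close>: after subtracting \<open>f(y)\<close> the function vanishes on the atom, so Cauchy-Schwarz against the indicator of
  the complement bounds the square of its mean by \<open>1 - \<gamma>\<close> times its second moment.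
\<close>

lemma square_expectation_atom:
  fixes f :: "'b \<Rightarrow> real"
  assumes [intro]: "bounded (range f)" and atom: "pmf w y \<ge> \<gamma>"
  shows "(measure_pmf.expectation w f)\<^sup>2 + \<gamma> * measure_pmf.expectation w (\<lambda>x. (f x - f y)\<^sup>2)
    \<le> measure_pmf.expectation w (\<lambda>x. (f x)\<^sup>2)"
proof -
  define h where "h x = f x - f y" for x
  have bdd_h [intro]: "bounded (range h)"
    unfolding h_def by (intro bounded_intros assms)
  define A B where "A = measure_pmf.expectation w h"
    and "B = measure_pmf.expectation w (\<lambda>x. (h x)\<^sup>2)"
  have "B \<ge> 0" by (simp add: B_def)
  have "measure_pmf.expectation w (\<lambda>x. (of_bool (x \<noteq> y) :: real)\<^sup>2) = measure_pmf.expectation w (indicator (- {y}))"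
    by (intro Bochner_Integration.integral_cong) (auto simp: indicator_def)
  also have "\<dots> = 1 - pmf w y"
    by (simp add: measure_pmf.prob_compl[of "{y}", simplified] Compl_eq_Diff_UNIV measure_pmf_single)
  finally have off: "measure_pmf.expectation w (\<lambda>x. (of_bool (x \<noteq> y) :: real)\<^sup>2) = 1 - pmf w y" .
  have "A = measure_pmf.expectation w (\<lambda>x. h x * of_bool (x \<noteq> y))"
    unfolding A_def by (intro Bochner_Integration.integral_cong) (auto simp: h_def)
  then have "A\<^sup>2 \<le> B * (1 - pmf w y)"
    using pmf_Cauchy_Schwarz[OF bdd_h bounded_range_of_bool, of w "\<lambda>x. x \<noteq> y"]
    by (simp only: off B_def)
  also have "\<dots> \<le> B * (1 - \<gamma>)"
    using atom \<open>B \<ge> 0\<close> by (intro mult_left_mono) auto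
  finally have AB: "A\<^sup>2 + \<gamma> * B \<le> B" by (simp add: algebra_simps)
  have Ef: "measure_pmf.expectation w f = A + f y"
    unfolding A_def h_def
    by (subst Bochner_Integration.integral_diff) (auto intro!: integrable_intros assms)
  have "measure_pmf.expectation w (\<lambda>x. (f x)\<^sup>2)
      = measure_pmf.expectation w (\<lambda>x. (h x)\<^sup>2 + 2 * f y * h x + (f y)\<^sup>2)"
    by (intro Bochner_Integration.integral_cong) (auto simp: h_def power2_eq_square algebra_simps)
  also have "\<dots> = B + 2 * f y * A + (f y)\<^sup>2"
    unfolding A_def B_def
    by (subst Bochner_Integration.integral_add Bochner_Integration.integral_mult_right_zero;
        (intro integrable_intros bdd_h)?)+ simp
  finally show ?thesis
    using AB unfolding Ef h_def[symmetric] B_def[symmetric] by (simp add: power2_eq_square algebra_simps)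
qed

section \<open>The law of a stationary edge\<close>

text \<open>
  The joint law of two consecutive states of the chain started in \<open>\<pi>\<close>. Its point masses are the numbers
  \<open>Q(x,y)\<close>, so \<open>flow\<close> is its measure on rectangles, and stationarity says that its two marginals agree.
\<close>

definition edge_pmf :: "('a \<Rightarrow> 'a pmf) \<Rightarrow> 'a pmf \<Rightarrow> ('a \<times> 'a) pmf" where
  "edge_pmf P \<pi> = bind_pmf \<pi> (\<lambda>x. map_pmf (Pair x) (P x))"

lemma pmf_edge: "pmf (edge_pmf P \<pi>) (x, y) = pmf \<pi> x * pmf (P x) y"
proof -
  have eq: "pmf (map_pmf (Pair z) (P z)) (x, y) = indicator {x} z * pmf (P x) y" for z
  proof (cases "z = x")
    case True
    have "Pair x -` {(x, y)} = {y}" by auto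
    with True show ?thesis by (simp add: pmf_map measure_pmf_single)
  next
    case False
    then have "Pair z -` {(x, y)} = {}" by auto
    with False show ?thesis by (simp add: pmf_map)
  qed
  show ?thesis
    by (simp add: edge_pmf_def pmf_bind eq measure_pmf_single)
qed

lemma expectation_edge:
  fixes F :: "'a \<times> 'a \<Rightarrow> real"
  assumes "bounded (range F)" "\<And>e. F e \<ge> 0"
  shows "measure_pmf.expectation (edge_pmf P \<pi>) F
    = measure_pmf.expectation \<pi> (\<lambda>x. measure_pmf.expectation (P x) (\<lambda>y. F (x, y)))"
  unfolding edge_pmf_def using assms by (subst expectation_nonneg_bind_pmf) auto

lemma map_fst_edge: "map_pmf fst (edge_pmf P \<pi>) = \<pi>"
  by (simp add: edge_pmf_def map_bind_pmf pmf.map_comp o_def bind_return_pmf' map_pmf_const)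

lemma map_snd_edge: "map_pmf snd (edge_pmf P \<pi>) = bind_pmf \<pi> P"
  by (simp add: edge_pmf_def map_bind_pmf pmf.map_comp o_def pmf.map_ident)

lemma measure_pmf_has_sum: "(pmf p has_sum measure_pmf.prob p A) A"
proof -
  have "pmf p summable_on A"
    by (rule abs_summable_summable[OF abs_summable_equivalent[THEN iffD2, OF pmf_abs_summable]])
  moreover have "measure_pmf.prob p A = infsum (pmf p) A"
    by (simp add: measure_pmf_conv_infsetsum infsetsum_infsum pmf_abs_summable)
  ultimately show ?thesis by (metis has_sum_infsum)
qed

lemma flow_eq_prob_edge: "flow P \<pi> S A = measure_pmf.prob (edge_pmf P \<pi>) (S \<times> A)"
proof -
  have "(\<lambda>(s, a). pmf \<pi> s * pmf (P s) a) = pmf (edge_pmf P \<pi>)"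
    by (auto simp: pmf_edge)
  then show ?thesis
    unfolding flow_def by (simp add: infsumI[OF measure_pmf_has_sum])
qed

lemma stationary_iff_bind: "stationary P \<pi> \<longleftrightarrow> bind_pmf \<pi> P = \<pi>"
proof -
  have "((\<lambda>x. pmf \<pi> x * pmf (P x) y) has_sum pmf (bind_pmf \<pi> P) y) UNIV" for y
  proof -
    have "pmf (bind_pmf \<pi> P) y = measure_pmf.prob (edge_pmf P \<pi>) (snd -` {y})"
      by (simp add: pmf_map flip: map_snd_edge)
    also have "snd -` {y} = (\<lambda>x. (x, y)) ` UNIV"
      by auto
    finally have "(pmf (edge_pmf P \<pi>) has_sum pmf (bind_pmf \<pi> P) y) ((\<lambda>x. (x, y)) ` UNIV)"
      using measure_pmf_has_sum by metis
    then show ?thesis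
      by (subst (asm) has_sum_reindex) (auto simp: inj_on_def o_def pmf_edge)
  qed
  then show ?thesis
    unfolding stationary_def by (metis has_sum_unique pmf_eqI)
qed

text \<open>
  The factor \<open>c\<close> stands inside the integral so that isoperimetric inequalities
  \<open>c \<pi>(S) \<le> Q(S, S\<^sup>c)\<close> can be inserted level by level.
\<close>

lemma layer_cake_pmf:
  fixes p :: "'b::countable pmf" and a b :: "'b \<Rightarrow> real" and c :: ennreal
  shows "(\<integral>\<^sup>+t. c * emeasure (measure_pmf p) {z. a z \<le> t \<and> t < b z} \<partial>lborel)
    = c * (\<integral>\<^sup>+z. ennreal (b z - a z) \<partial>measure_pmf p)"
proof -
  have em: "emeasure (measure_pmf p) {z. a z \<le> t \<and> t < b z}
      = (\<integral>\<^sup>+z. ennreal (pmf p z) * indicator {a z..<b z} t \<partial>count_space UNIV)" for t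
    by (subst nn_integral_indicator[symmetric], simp, subst nn_integral_measure_pmf,
        intro nn_integral_cong) (auto simp: indicator_def)
  have "(\<integral>\<^sup>+t. c * emeasure (measure_pmf p) {z. a z \<le> t \<and> t < b z} \<partial>lborel)
      = (\<integral>\<^sup>+t. (\<integral>\<^sup>+z. c * (ennreal (pmf p z) * indicator {a z..<b z} t) \<partial>count_space UNIV) \<partial>lborel)"
    by (simp add: em nn_integral_cmult)
  also have "\<dots> = (\<integral>\<^sup>+z. (\<integral>\<^sup>+t. c * (ennreal (pmf p z) * indicator {a z..<b z} t) \<partial>lborel) \<partial>count_space UNIV)"
    by (intro nn_integral_count_space_nn_integral) auto
  also have "\<dots> = (\<integral>\<^sup>+z. c * (ennreal (pmf p z) * ennreal (b z - a z)) \<partial>count_space UNIV)"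
  proof (intro nn_integral_cong)
    fix z
    have "emeasure lborel {a z..<b z} = ennreal (b z - a z)"
      by (cases "a z \<le> b z") (auto simp: ennreal_neg)
    then show "(\<integral>\<^sup>+t. c * (ennreal (pmf p z) * indicator {a z..<b z} t) \<partial>lborel)
        = c * (ennreal (pmf p z) * ennreal (b z - a z))"
      by (simp add: nn_integral_cmult)
  qed
  also have "\<dots> = c * (\<integral>\<^sup>+z. ennreal (b z - a z) \<partial>measure_pmf p)"
    by (simp add: nn_integral_cmult nn_integral_measure_pmf)
  finally show ?thesis .
qed

text \<open>
  The drop of \<open>F\<close> along an edge is the length of the set of levels \<open>t\<close> whose superlevel set the edge leaves.
  Integrating over \<open>t\<close> turns an isoperimetric inequality for all superlevel sets into one for \<open>F\<close>.
\<close>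

lemma edge_coarea:
  fixes F :: "'a::countable \<Rightarrow> real"
  assumes nonneg: "\<And>x. F x \<ge> 0"
    and level: "\<And>t. t \<ge> 0 \<Longrightarrow> c * emeasure (measure_pmf \<pi>) {x. F x > t}
      \<le> emeasure (measure_pmf (edge_pmf P \<pi>)) ({x. F x > t} \<times> - {x. F x > t})"
  shows "c * (\<integral>\<^sup>+x. ennreal (F x) \<partial>measure_pmf \<pi>)
    \<le> (\<integral>\<^sup>+e. ennreal (F (fst e) - F (snd e)) \<partial>measure_pmf (edge_pmf P \<pi>))"
proof -
  have "c * (\<integral>\<^sup>+x. ennreal (F x) \<partial>measure_pmf \<pi>)
      = (\<integral>\<^sup>+t. c * emeasure (measure_pmf \<pi>) {x. 0 \<le> t \<and> t < F x} \<partial>lborel)"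
    using layer_cake_pmf[of c \<pi> "\<lambda>_. 0" F] by simp
  also have "\<dots> \<le> (\<integral>\<^sup>+t. 1 * emeasure (measure_pmf (edge_pmf P \<pi>))
      {e. F (snd e) \<le> t \<and> t < F (fst e)} \<partial>lborel)"
  proof (intro nn_integral_mono)
    fix t :: real
    show "c * emeasure (measure_pmf \<pi>) {x. 0 \<le> t \<and> t < F x}
      \<le> 1 * emeasure (measure_pmf (edge_pmf P \<pi>)) {e. F (snd e) \<le> t \<and> t < F (fst e)}"
    proof (cases "t \<ge> 0")
      case True
      have "{e. F (snd e) \<le> t \<and> t < F (fst e)} = {x. F x > t} \<times> - {x. F x > t}"
        by auto
      with level[OF True] True show ?thesis by simp
    qed simp
  qed
  also have "\<dots> = (\<integral>\<^sup>+e. ennreal (F (fst e) - F (snd e)) \<partial>measure_pmf (edge_pmf P \<pi>))"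
    by (subst layer_cake_pmf) simp
  finally show ?thesis .
qed

section \<open>Energy and conductance\<close>

text \<open>
  Multiplying out the quotient makes the inequality meaningful for all sets, the empty one included, and also when
  the profile is infinite, since then only the empty set has measure at most \<open>r\<close>.
\<close>

lemma profile_mult_prob_le_flow:
  assumes "measure_pmf.prob \<pi> S \<le> r" "r \<le> 1/2"
  shows "conductance_profile P \<pi> r * emeasure (measure_pmf \<pi>) S
    \<le> emeasure (measure_pmf (edge_pmf P \<pi>)) (S \<times> - S)"
proof (cases "measure_pmf.prob \<pi> S = 0")
  case True
  then have "emeasure (measure_pmf \<pi>) S = 0"
    by (simp add: measure_pmf.emeasure_eq_measure)
  then show ?thesis by simp
next
  case False
  then have pos: "measure_pmf.prob \<pi> S > 0"
    by (simp add: zero_less_measure_iff)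
  then have "S \<noteq> {}" by auto
  with assms have "conductance_profile P \<pi> r \<le> ennreal (conductance P \<pi> S)"
    unfolding conductance_profile_def by (auto intro!: INF_lower)
  then have "conductance_profile P \<pi> r * emeasure (measure_pmf \<pi>) S
      \<le> ennreal (conductance P \<pi> S) * emeasure (measure_pmf \<pi>) S"
    by (rule mult_right_mono) simp
  also have "\<dots> = ennreal (conductance P \<pi> S * measure_pmf.prob \<pi> S)"
    by (simp add: measure_pmf.emeasure_eq_measure ennreal_mult'')
  also have "conductance P \<pi> S * measure_pmf.prob \<pi> S = measure_pmf.prob (edge_pmf P \<pi>) (S \<times> - S)"
    using pos by (simp add: conductance_def flow_eq_prob_edge)
  finally show ?thesis by (simp add: measure_pmf.emeasure_eq_measure)
qed

lemma profile_antimono: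
  assumes "r \<le> s"
  shows "conductance_profile P \<pi> s \<le> conductance_profile P \<pi> r"
  unfolding conductance_profile_def Let_def using assms
  by (intro INF_superset_mono) (auto split: if_splits)

locale lazy_chain =
  fixes P :: "'a::countable \<Rightarrow> 'a pmf" and \<pi> :: "'a pmf" and \<gamma> :: real
  assumes invariant: "bind_pmf \<pi> P = \<pi>"
    and holding: "\<And>z. pmf (P z) z \<ge> \<gamma>"
    and \<gamma>_pos: "\<gamma> > 0" and \<gamma>_less_1: "\<gamma> < 1"
begin

abbreviation edge :: "('a \<times> 'a) pmf" where
  "edge \<equiv> edge_pmf P \<pi>"

text \<open>
  This is twice the usual Dirichlet form of the chain.
\<close>

definition energy :: "('a \<Rightarrow> real) \<Rightarrow> real" where
  "energy f = measure_pmf.expectation edge (\<lambda>e. (f (fst e) - f (snd e))\<^sup>2)"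

abbreviation transfer :: "('a \<Rightarrow> real) \<Rightarrow> 'a \<Rightarrow> real" where
  "transfer f x \<equiv> measure_pmf.expectation (P x) f"

lemma expectation_edge_fst:
  fixes f :: "'a \<Rightarrow> real"
  shows "measure_pmf.expectation edge (\<lambda>e. f (fst e)) = measure_pmf.expectation \<pi> f"
  using integral_map_pmf[of fst edge f] by (simp add: map_fst_edge)

lemma expectation_edge_snd:
  fixes f :: "'a \<Rightarrow> real"
  shows "measure_pmf.expectation edge (\<lambda>e. f (snd e)) = measure_pmf.expectation \<pi> f"
  using integral_map_pmf[of snd edge f] by (simp add: map_snd_edge invariant)

lemma bounded_fst_snd:
  fixes f :: "'a \<Rightarrow> real"
  assumes "bounded (range f)"
  shows "bounded (range (\<lambda>e::'a \<times> 'a. f (fst e)))" "bounded (range (\<lambda>e::'a \<times> 'a. f (snd e)))"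
  using assms by (auto intro: bounded_range_compose)

lemma energy_nonneg: "energy f \<ge> 0"
  by (simp add: energy_def)

lemma energy_mono:
  assumes "bounded (range f)" "bounded (range g)"
    and "\<And>x y. (f x - f y)\<^sup>2 \<le> (g x - g y)\<^sup>2"
  shows "energy f \<le> energy g"
  unfolding energy_def using assms
  by (intro integral_mono integrable_intros bounded_fst_snd) auto

text \<open>
  The variance of \<open>g\<close> under the one-step law from \<open>x\<close> is lost when \<open>g(x)\<close> is replaced by \<open>(P g)(x)\<close>. Since that
  law has an atom of mass at least \<open>\<gamma>\<close> at \<open>x\<close>, \<open>square_expectation_atom\<close> bounds the loss below by
  \<open>\<gamma>\<close> times the mean of \<open>(g - g(x))\<^sup>2\<close>; averaging over \<open>x\<close> produces the energy.
\<close>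

lemma variance_decay:
  assumes bdd: "bounded (range g)"
  shows "measure_pmf.expectation \<pi> (\<lambda>x. (transfer g x)\<^sup>2) + \<gamma> * energy g
    \<le> measure_pmf.expectation \<pi> (\<lambda>x. (g x)\<^sup>2)"
proof -
  obtain B where B: "B > 0" "\<And>x. \<bar>g x\<bar> \<le> B" using bounded_rangeD[OF bdd] by blast
  have diff: "\<bar>(g y - g x)\<^sup>2\<bar> \<le> (2 * B)\<^sup>2" for x y
    using B(1) B(2)[of x] B(2)[of y] by (subst abs_power2, intro power2_le_iff_abs_le[THEN iffD2]) auto
  have sq: "\<bar>(g y)\<^sup>2\<bar> \<le> B\<^sup>2" for y
    using B(1) B(2)[of y] by (subst abs_power2, intro power2_le_iff_abs_le[THEN iffD2]) auto
  have bT: "bounded (range (transfer g))"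
    by (rule bounded_expectation[of "\<lambda>_. g" B]) (rule B)
  have bD: "bounded (range (\<lambda>x. measure_pmf.expectation (P x) (\<lambda>y. (g y - g x)\<^sup>2)))"
    by (rule bounded_expectation[of "\<lambda>x y. (g y - g x)\<^sup>2"]) (rule diff)
  have bS: "bounded (range (\<lambda>x. measure_pmf.expectation (P x) (\<lambda>y. (g y)\<^sup>2)))"
    by (rule bounded_expectation[of "\<lambda>x y. (g y)\<^sup>2"]) (rule sq)
  have "energy g = measure_pmf.expectation \<pi> (\<lambda>x. measure_pmf.expectation (P x) (\<lambda>y. (g y - g x)\<^sup>2))"
    unfolding energy_def
    by (subst expectation_edge)
       (auto intro!: bounded_intros bounded_fst_snd bdd simp: power2_commute)
  then have "measure_pmf.expectation \<pi> (\<lambda>x. (transfer g x)\<^sup>2) + \<gamma> * energy g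
      = measure_pmf.expectation \<pi> (\<lambda>x. (transfer g x)\<^sup>2
          + \<gamma> * measure_pmf.expectation (P x) (\<lambda>y. (g y - g x)\<^sup>2))"
    by (subst Bochner_Integration.integral_add) (auto intro!: integrable_intros bT bD)
  also have "\<dots> \<le> measure_pmf.expectation \<pi> (\<lambda>x. measure_pmf.expectation (P x) (\<lambda>y. (g y)\<^sup>2))"
    using bdd holding
    by (intro integral_mono square_expectation_atom integrable_intros bT bD integrable_pmf_bounded[OF bS])
  also have "\<dots> = measure_pmf.expectation (bind_pmf \<pi> P) (\<lambda>x. (g x)\<^sup>2)"
    using bdd by (subst expectation_nonneg_bind_pmf) (auto intro!: bounded_intros)
  finally show ?thesis by (simp add: invariant)
qed

text \<open>
  Factor \<open>f(x)\<^sup>2 - f(y)\<^sup>2 = (f(x) - f(y)) (f(x) + f(y))\<close>. Loops contribute nothing, so the second factor may be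
  restricted to edges with \<open>x \<noteq> y\<close>, and these carry mass at most \<open>(1 - \<gamma>) \<pi>(x)\<close> out of, and into, each state.
\<close>

lemma energy_Cauchy_Schwarz:
  assumes bdd: "bounded (range f)"
  shows "(measure_pmf.expectation edge (\<lambda>e. \<bar>(f (fst e))\<^sup>2 - (f (snd e))\<^sup>2\<bar>))\<^sup>2
    \<le> 4 * (1 - \<gamma>) * measure_pmf.expectation \<pi> (\<lambda>x. (f x)\<^sup>2) * energy f"
proof -
  note bf = bounded_fst_snd[OF bdd]
  define N where "N = measure_pmf.expectation \<pi> (\<lambda>x. (f x)\<^sup>2)"
  define d s where "d e = \<bar>f (fst e) - f (snd e)\<bar>"
    and "s e = of_bool (fst e \<noteq> snd e) * \<bar>f (fst e) + f (snd e)\<bar>" for e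
  define stay where "stay e = of_bool (fst e = snd e) * (f (fst e))\<^sup>2" for e
  have bd: "bounded (range d)" unfolding d_def by (intro bounded_intros bf)
  have bs: "bounded (range s)" unfolding s_def by (intro bounded_intros bf)
  have bstay: "bounded (range stay)" unfolding stay_def by (intro bounded_intros bf)
  have ds: "d e * s e = \<bar>(f (fst e))\<^sup>2 - (f (snd e))\<^sup>2\<bar>" for e
    by (auto simp: d_def s_def power2_eq_square algebra_simps simp flip: abs_mult)
  have "\<gamma> * N = measure_pmf.expectation \<pi> (\<lambda>x. \<gamma> * (f x)\<^sup>2)"
    by (simp add: N_def)
  also have "\<dots> \<le> measure_pmf.expectation \<pi> (\<lambda>x. pmf (P x) x * (f x)\<^sup>2)"
    using holding
    by (intro integral_mono integrable_intros bdd mult_right_mono bounded_rangeI[of "\<lambda>x. pmf (P x) x" 1])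
       (auto simp: pmf_le_1)
  also have "\<dots> = measure_pmf.expectation \<pi> (\<lambda>x. measure_pmf.expectation (P x) (\<lambda>y. stay (x, y)))"
  proof (intro Bochner_Integration.integral_cong refl)
    fix x
    have "measure_pmf.expectation (P x) (\<lambda>y. stay (x, y))
        = measure_pmf.expectation (P x) (\<lambda>y. indicator {x} y * (f x)\<^sup>2)"
      by (intro Bochner_Integration.integral_cong) (auto simp: stay_def indicator_def)
    then show "pmf (P x) x * (f x)\<^sup>2 = measure_pmf.expectation (P x) (\<lambda>y. stay (x, y))"
      by (simp add: measure_pmf_single)
  qed
  also have "\<dots> = measure_pmf.expectation edge stay"
    using bstay by (subst expectation_edge) (auto simp: stay_def)
  finally have stay_ge: "\<gamma> * N \<le> measure_pmf.expectation edge stay" .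
  have "measure_pmf.expectation edge (\<lambda>e. (s e)\<^sup>2)
      \<le> measure_pmf.expectation edge (\<lambda>e. 2 * (f (fst e))\<^sup>2 + 2 * (f (snd e))\<^sup>2 - 4 * stay e)"
  proof (intro integral_mono integrable_intros bf bs bstay)
    fix e
    have "(f (fst e) + f (snd e))\<^sup>2 \<le> 2 * (f (fst e))\<^sup>2 + 2 * (f (snd e))\<^sup>2"
      using zero_le_power2[of "f (fst e) - f (snd e)"] by (simp add: power2_eq_square algebra_simps)
    then show "(s e)\<^sup>2 \<le> 2 * (f (fst e))\<^sup>2 + 2 * (f (snd e))\<^sup>2 - 4 * stay e"
      by (auto simp: s_def stay_def)
  qed
  also have "\<dots> = 2 * N + 2 * N - 4 * measure_pmf.expectation edge stay"
    using expectation_edge_fst[of "\<lambda>x. (f x)\<^sup>2"] expectation_edge_snd[of "\<lambda>x. (f x)\<^sup>2"]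
    by (subst Bochner_Integration.integral_add Bochner_Integration.integral_diff
          Bochner_Integration.integral_mult_right_zero;
        (intro integrable_intros bf bstay)?)+ (simp add: N_def)
  finally have s_le: "measure_pmf.expectation edge (\<lambda>e. (s e)\<^sup>2) \<le> 4 * (1 - \<gamma>) * N"
    using stay_ge by (simp add: algebra_simps)
  have "(measure_pmf.expectation edge (\<lambda>e. d e * s e))\<^sup>2
      \<le> measure_pmf.expectation edge (\<lambda>e. (d e)\<^sup>2) * measure_pmf.expectation edge (\<lambda>e. (s e)\<^sup>2)"
    by (rule pmf_Cauchy_Schwarz[OF bd bs])
  also have "measure_pmf.expectation edge (\<lambda>e. (d e)\<^sup>2) = energy f"
    by (simp add: d_def energy_def)
  also have "energy f * measure_pmf.expectation edge (\<lambda>e. (s e)\<^sup>2) \<le> energy f * (4 * (1 - \<gamma>) * N)"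
    using s_le energy_nonneg by (rule mult_left_mono)
  finally show ?thesis unfolding ds N_def by (simp add: mult_ac)
qed

text \<open>
  The positive part of a number is half the sum of the number and its absolute value, and the increment of \<open>F\<close>
  along the edge has mean zero because both marginals of the edge law are \<open>\<pi>\<close>. This replaces the symmetry \<open>Q(x,y) = Q(y,x)\<close> that a
  reversible chain would offer.
\<close>

lemma edge_half_variation:
  assumes bdd: "bounded (range F)"
  shows "(\<integral>\<^sup>+e. ennreal (F (fst e) - F (snd e)) \<partial>measure_pmf edge)
    = ennreal (measure_pmf.expectation edge (\<lambda>e. \<bar>F (fst e) - F (snd e)\<bar>) / 2)"
proof -
  note bF = bounded_fst_snd[OF bdd]
  have "(\<integral>\<^sup>+e. ennreal (F (fst e) - F (snd e)) \<partial>measure_pmf edge)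
      = (\<integral>\<^sup>+e. ennreal (max 0 (F (fst e) - F (snd e))) \<partial>measure_pmf edge)"
    by (intro nn_integral_cong) (auto simp: max_def ennreal_neg)
  also have "\<dots> = ennreal (measure_pmf.expectation edge (\<lambda>e. max 0 (F (fst e) - F (snd e))))"
    by (intro nn_integral_eq_integral integrable_intros bF) auto
  also have "(\<lambda>e. max 0 (F (fst e) - F (snd e)))
      = (\<lambda>e. (1/2) * \<bar>F (fst e) - F (snd e)\<bar> + (1/2) * (F (fst e) - F (snd e)))"
    by (rule ext) (simp add: max_def abs_if field_simps)
  also have "measure_pmf.expectation edge \<dots>
      = (1/2) * measure_pmf.expectation edge (\<lambda>e. \<bar>F (fst e) - F (snd e)\<bar>)
        + (1/2) * (measure_pmf.expectation \<pi> F - measure_pmf.expectation \<pi> F)"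
    using expectation_edge_fst[of F] expectation_edge_snd[of F]
    by (subst Bochner_Integration.integral_add Bochner_Integration.integral_diff
          Bochner_Integration.integral_mult_right_zero;
        (intro integrable_intros bF)?)+ simp
  finally show ?thesis by simp
qed

text \<open>
  With \<open>N = \<parallel>f\<parallel>\<^sup>2\<close> and \<open>A\<close> the total variation of \<open>f\<^sup>2\<close> along the edges, the coarea inequality gives
  \<open>\<Phi>(r) N \<le> A/2\<close> and Cauchy-Schwarz gives \<open>A\<^sup>2 \<le> 4 (1 - \<gamma>) N D(f)\<close>; squaring the first and cancelling \<open>N\<close>
  yields the claim.
\<close>

lemma Cheeger_inequality:
  assumes bdd: "bounded (range f)" and nonneg: "\<And>x. f x \<ge> 0"
    and supp: "measure_pmf.prob \<pi> {x. f x > 0} \<le> r" and r: "r \<le> 1/2"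
  shows "(conductance_profile P \<pi> r)\<^sup>2 * ennreal (measure_pmf.expectation \<pi> (\<lambda>x. (f x)\<^sup>2))
    \<le> ennreal ((1 - \<gamma>) * energy f)"
proof -
  define \<phi> where "\<phi> = conductance_profile P \<pi> r"
  define N where "N = measure_pmf.expectation \<pi> (\<lambda>x. (f x)\<^sup>2)"
  define A where "A = measure_pmf.expectation edge (\<lambda>e. \<bar>(f (fst e))\<^sup>2 - (f (snd e))\<^sup>2\<bar>)"
  have "N \<ge> 0" "A \<ge> 0" by (simp_all add: N_def A_def)
  have b2: "bounded (range (\<lambda>x. (f x)\<^sup>2))" by (intro bounded_intros bdd)
  have "\<phi> * ennreal N = \<phi> * (\<integral>\<^sup>+x. ennreal ((f x)\<^sup>2) \<partial>measure_pmf \<pi>)"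
    unfolding N_def by (subst nn_integral_eq_integral) (auto intro!: integrable_intros bdd)
  also have "\<dots> \<le> (\<integral>\<^sup>+e. ennreal ((f (fst e))\<^sup>2 - (f (snd e))\<^sup>2) \<partial>measure_pmf edge)"
  proof (rule edge_coarea)
    fix t :: real assume "t \<ge> 0"
    have "measure_pmf.prob \<pi> {x. (f x)\<^sup>2 > t} \<le> measure_pmf.prob \<pi> {x. f x > 0}"
      using \<open>t \<ge> 0\<close> nonneg by (intro measure_pmf.finite_measure_mono)
        (auto, metis less_eq_real_def not_le zero_power2)
    with supp r show "\<phi> * emeasure (measure_pmf \<pi>) {x. t < (f x)\<^sup>2}
        \<le> emeasure (measure_pmf edge) ({x. t < (f x)\<^sup>2} \<times> - {x. t < (f x)\<^sup>2})"
      unfolding \<phi>_def by (intro profile_mult_prob_le_flow) auto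
  qed simp
  also have "\<dots> = ennreal (A / 2)"
    unfolding A_def by (rule edge_half_variation[OF b2])
  finally have main: "\<phi> * ennreal N \<le> ennreal (A / 2)" .
  have A2: "A\<^sup>2 \<le> 4 * (1 - \<gamma>) * N * energy f"
    unfolding A_def N_def by (rule energy_Cauchy_Schwarz[OF bdd])
  have "\<phi>\<^sup>2 * ennreal N \<le> ennreal ((1 - \<gamma>) * energy f)"
  proof (cases "N = 0")
    case False
    with \<open>N \<ge> 0\<close> have N: "N > 0" by simp
    have "\<phi> \<noteq> top"
      using main N by (auto simp: ennreal_top_mult top_unique)
    then obtain t where t: "t \<ge> 0" "\<phi> = ennreal t"
      by (cases \<phi>) auto
    have "t * N \<le> A / 2"
      using main t \<open>A \<ge> 0\<close> N by (simp flip: ennreal_mult)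
    then have "(t * N)\<^sup>2 \<le> (A / 2)\<^sup>2"
      using t N by (intro power_mono) auto
    also have "\<dots> \<le> (1 - \<gamma>) * N * energy f"
      using A2 by (simp add: power_divide algebra_simps)
    finally have "(t\<^sup>2 * N) * N \<le> ((1 - \<gamma>) * energy f) * N"
      by (simp add: power2_eq_square mult_ac)
    then have "t\<^sup>2 * N \<le> (1 - \<gamma>) * energy f"
      using N by simp
    then show ?thesis
      using t N by (simp add: ennreal_power ennreal_leI flip: ennreal_mult)
  qed simp
  then show ?thesis unfolding \<phi>_def N_def .
qed

end

text \<open>
  The median is the infimum of all \<open>t\<close> with at most half of the mass strictly above \<open>t\<close>; both bounds
  pass to the limit by continuity of the measure along increasing unions.
\<close>

lemma pmf_median:
  fixes g :: "'b \<Rightarrow> real"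
  assumes "bounded (range g)"
  obtains m where "measure_pmf.prob p {x. g x > m} \<le> 1/2" "measure_pmf.prob p {x. g x < m} \<le> 1/2"
proof -
  obtain B where B: "B > 0" "\<And>x. \<bar>g x\<bar> \<le> B" using bounded_rangeD[OF assms] by blast
  define T where "T = {t. measure_pmf.prob p {x. g x > t} \<le> 1/2}"
  have "{x. g x > B} = {}" using B by (auto simp: abs_le_iff not_less)
  then have "B \<in> T" by (simp add: T_def)
  have above: "- B - 1 \<le> t" if "t \<in> T" for t
  proof (rule ccontr)
    assume "\<not> - B - 1 \<le> t"
    then have "{x. g x > t} = UNIV" using B(2) by (auto simp: abs_le_iff) (smt (verit))
    with that show False by (simp add: T_def)
  qed
  then have bdd: "bdd_below T" by (rule bdd_belowI)
  define m where "m = Inf T"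
  show ?thesis
  proof
    have inc: "incseq (\<lambda>k. {x. g x > m + 1 / Suc k})"
      by (rule incseq_SucI) (auto, smt (verit) frac_le of_nat_0_le_iff)
    have eq: "{x. g x > m} = (\<Union>k. {x. g x > m + 1 / Suc k})"
    proof (intro equalityI subsetI)
      fix x assume "x \<in> {x. g x > m}"
      then obtain k where "1 / Suc k < g x - m"
        using reals_Archimedean[of "g x - m"] by (auto simp: inverse_eq_divide)
      then show "x \<in> (\<Union>k. {x. g x > m + 1 / Suc k})" by (auto intro!: exI[of _ k])
    qed (auto, smt (verit) divide_nonneg_nonneg of_nat_0_le_iff)
    have "measure_pmf.prob p {x. g x > m + 1 / Suc k} \<le> 1/2" for k
    proof -
      have "Inf T < m + 1 / Suc k" by (simp add: m_def)
      then obtain t where t: "t \<in> T" "t < m + 1 / Suc k"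
        using \<open>B \<in> T\<close> cInf_lessD[of T "m + 1 / Suc k"] by blast
      then have "measure_pmf.prob p {x. g x > m + 1 / Suc k} \<le> measure_pmf.prob p {x. g x > t}"
        by (intro measure_pmf.finite_measure_mono) auto
      with t show ?thesis by (simp add: T_def)
    qed
    then show "measure_pmf.prob p {x. g x > m} \<le> 1/2"
      using measure_pmf.finite_Lim_measure_incseq[of "\<lambda>k. {x. g x > m + 1 / Suc k}" p] inc
      unfolding eq by (intro LIMSEQ_le_const2) auto
  next
    have inc: "incseq (\<lambda>k. {x. g x \<le> m - 1 / Suc k})"
      by (rule incseq_SucI) (auto, smt (verit) frac_le of_nat_0_le_iff)
    have eq: "{x. g x < m} = (\<Union>k. {x. g x \<le> m - 1 / Suc k})"
    proof (intro equalityI subsetI)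
      fix x assume "x \<in> {x. g x < m}"
      then obtain k where "1 / Suc k < m - g x"
        using reals_Archimedean[of "m - g x"] by (auto simp: inverse_eq_divide)
      then show "x \<in> (\<Union>k. {x. g x \<le> m - 1 / Suc k})" by (auto intro!: exI[of _ k])
    qed (auto, smt (verit) divide_pos_pos of_nat_0_le_iff)
    have "measure_pmf.prob p {x. g x \<le> m - 1 / Suc k} \<le> 1/2" for k
    proof -
      have "m - 1 / Suc k \<notin> T"
        using cInf_lower[OF _ bdd, of "m - 1 / Suc k"] by (auto simp: m_def)
      then have "measure_pmf.prob p {x. g x > m - 1 / Suc k} > 1/2"
        by (simp add: T_def)
      moreover have "{x. g x \<le> m - 1 / Suc k} = UNIV - {x. g x > m - 1 / Suc k}"
        by auto
      ultimately show ?thesis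
        using measure_pmf.prob_compl[of "{x. g x > m - 1 / Suc k}" p] by simp
    qed
    then show "measure_pmf.prob p {x. g x < m} \<le> 1/2"
      using measure_pmf.finite_Lim_measure_incseq[of "\<lambda>k. {x. g x \<le> m - 1 / Suc k}" p] inc
      unfolding eq by (intro LIMSEQ_le_const2) auto
  qed
qed

context lazy_chain
begin

text \<open>
  Truncation at \<open>c = V/4\<close> uses \<open>((g - c)\<^sup>+)\<^sup>2 \<ge> g\<^sup>2 - 2cg\<close>, whose mean is \<open>1 + V - 2c \<ge> V/2\<close>, and the support of
  \<open>(g - c)\<^sup>+\<close> has measure at most \<open>1/c = 4/V\<close>.
\<close>

lemma energy_lower_bound_truncation:
  assumes bdd: "bounded (range g)" and nonneg: "\<And>x. g x \<ge> 0"
    and mean: "measure_pmf.expectation \<pi> g = 1"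
    and V: "measure_pmf.expectation \<pi> (\<lambda>x. (g x)\<^sup>2) = 1 + V" "V > 0" "4 / V \<le> 1/2"
  shows "(conductance_profile P \<pi> (4 / V))\<^sup>2 * ennreal (V / 2) \<le> ennreal ((1 - \<gamma>) * energy g)"
proof -
  define c where "c = V / 4"
  define f where "f x = max 0 (g x - c)" for x
  have "c > 0" using V by (simp add: c_def)
  have bf: "bounded (range f)" unfolding f_def by (intro bounded_intros bdd)
  have "c * measure_pmf.prob \<pi> {x. f x > 0} = measure_pmf.expectation \<pi> (\<lambda>x. c * indicator {x. f x > 0} x)"
    by simp
  also have "\<dots> \<le> measure_pmf.expectation \<pi> g"
    using nonneg
    by (intro integral_mono integrable_pmf_bounded bdd bounded_range_mult bounded_range_const
          bounded_rangeI[of "indicator {x. f x > 0}" 1])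
       (auto simp: f_def indicator_def max_def)
  finally have "measure_pmf.prob \<pi> {x. f x > 0} \<le> 4 / V"
    using V by (simp add: mean c_def field_simps)
  then have "(conductance_profile P \<pi> (4 / V))\<^sup>2 * ennreal (measure_pmf.expectation \<pi> (\<lambda>x. (f x)\<^sup>2))
      \<le> ennreal ((1 - \<gamma>) * energy f)"
    using V by (intro Cheeger_inequality bf) (auto simp: f_def)
  also have "energy f \<le> energy g"
    by (rule energy_mono[OF bf bdd], rule power2_le_iff_abs_le[THEN iffD2, of "\<bar>_\<bar>", unfolded power2_abs])
       (auto simp: f_def)
  finally have "(conductance_profile P \<pi> (4 / V))\<^sup>2 * ennreal (measure_pmf.expectation \<pi> (\<lambda>x. (f x)\<^sup>2))
      \<le> ennreal ((1 - \<gamma>) * energy g)"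
    using \<gamma>_less_1 by (simp add: ennreal_leI mult_left_mono)
  moreover have "V / 2 \<le> measure_pmf.expectation \<pi> (\<lambda>x. (f x)\<^sup>2)"
  proof -
    have "V / 2 \<le> (1 + V) - 2 * c * 1" by (simp add: c_def)
    also have "\<dots> = measure_pmf.expectation \<pi> (\<lambda>x. (g x)\<^sup>2 - 2 * c * g x)"
      by (subst Bochner_Integration.integral_diff) (auto intro!: integrable_intros bdd simp: mean V)
    also have "\<dots> \<le> measure_pmf.expectation \<pi> (\<lambda>x. (f x)\<^sup>2)"
    proof (intro integral_mono integrable_intros bdd bf)
      fix x
      show "(g x)\<^sup>2 - 2 * c * g x \<le> (f x)\<^sup>2"
      proof (cases "g x \<ge> c")
        case True
        then show ?thesis by (simp add: f_def power2_eq_square algebra_simps)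
      next
        case False
        then have "g x * (g x - 2 * c) \<le> 0"
          using nonneg[of x] \<open>c > 0\<close> by (intro mult_nonneg_nonpos) auto
        then show ?thesis using False by (simp add: f_def power2_eq_square algebra_simps)
      qed
    qed
    finally show ?thesis .
  qed
  ultimately show ?thesis
    by (meson ennreal_leI mult_left_mono order_trans zero_le)
qed

text \<open>
  The positive and the negative part of \<open>g - m\<close>, with \<open>m\<close> a median, each live on a set of measure at most
  \<open>1/2\<close>; their energies add up to at most that of \<open>g\<close>, and their squared norms to at least the variance.
\<close>

lemma energy_lower_bound_median:
  assumes bdd: "bounded (range g)"
    and mean: "measure_pmf.expectation \<pi> g = 1"
    and V: "measure_pmf.expectation \<pi> (\<lambda>x. (g x)\<^sup>2) = 1 + V" "V \<ge> 0"
  shows "(conductance_profile P \<pi> (1/2))\<^sup>2 * ennreal V \<le> ennreal ((1 - \<gamma>) * energy g)"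
proof -
  obtain m where m: "measure_pmf.prob \<pi> {x. g x > m} \<le> 1/2" "measure_pmf.prob \<pi> {x. g x < m} \<le> 1/2"
    using pmf_median[OF bdd] by blast
  define f h where "f x = max 0 (g x - m)" and "h x = max 0 (m - g x)" for x
  define N where "N f = measure_pmf.expectation \<pi> (\<lambda>x. (f x)\<^sup>2)" for f :: "'a \<Rightarrow> real"
  have bf: "bounded (range f)" unfolding f_def by (intro bounded_intros bdd)
  have bh: "bounded (range h)" unfolding h_def by (intro bounded_intros bdd)
  have "{x. f x > 0} = {x. g x > m}" "{x. h x > 0} = {x. g x < m}"
    by (auto simp: f_def h_def)
  then have Cf: "(conductance_profile P \<pi> (1/2))\<^sup>2 * ennreal (N f) \<le> ennreal ((1 - \<gamma>) * energy f)"
    and Ch: "(conductance_profile P \<pi> (1/2))\<^sup>2 * ennreal (N h) \<le> ennreal ((1 - \<gamma>) * energy h)"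
    unfolding N_def using m
    by (auto intro!: Cheeger_inequality bf bh) (auto simp: f_def h_def)
  have nn: "N f \<ge> 0" "N h \<ge> 0" by (simp_all add: N_def)
  have "V \<le> V + (m - 1)\<^sup>2" by simp
  also have "\<dots> = (1 + V) - 2 * m * 1 + m\<^sup>2" by (simp add: power2_eq_square algebra_simps)
  also have "\<dots> = measure_pmf.expectation \<pi> (\<lambda>x. (g x)\<^sup>2 - 2 * m * g x + m\<^sup>2)"
    by (subst Bochner_Integration.integral_add Bochner_Integration.integral_diff;
        (intro integrable_intros bdd)?)+ (simp add: mean V)
  also have "\<dots> = measure_pmf.expectation \<pi> (\<lambda>x. (f x)\<^sup>2 + (h x)\<^sup>2)"
    by (intro Bochner_Integration.integral_cong)
       (auto simp: f_def h_def max_def power2_eq_square algebra_simps)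
  also have "\<dots> = N f + N h"
    unfolding N_def by (subst Bochner_Integration.integral_add) (auto intro!: integrable_intros bf bh)
  finally have "(conductance_profile P \<pi> (1/2))\<^sup>2 * ennreal V
      \<le> (conductance_profile P \<pi> (1/2))\<^sup>2 * ennreal (N f + N h)"
    by (intro mult_left_mono ennreal_leI) auto
  also have "\<dots> \<le> ennreal ((1 - \<gamma>) * energy f) + ennreal ((1 - \<gamma>) * energy h)"
    using nn add_mono[OF Cf Ch] by (simp add: distrib_left)
  also have "\<dots> = ennreal ((1 - \<gamma>) * (energy f + energy h))"
    using \<gamma>_less_1 energy_nonneg by (simp add: distrib_left)
  also have "energy f + energy h \<le> energy g"
  proof -
    have "energy f + energy h = measure_pmf.expectation edge
        (\<lambda>e. (f (fst e) - f (snd e))\<^sup>2 + (h (fst e) - h (snd e))\<^sup>2)"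
      unfolding energy_def
      by (subst Bochner_Integration.integral_add)
         (auto intro!: integrable_intros bounded_fst_snd bf bh)
    also have "\<dots> \<le> energy g"
      unfolding energy_def
    proof (intro integral_mono integrable_intros bounded_fst_snd bdd bf bh)
      fix e
      define a b c d where "a = f (fst e)" "b = f (snd e)" "c = h (fst e)" "d = h (snd e)"
      have nn: "a \<ge> 0" "b \<ge> 0" "c \<ge> 0" "d \<ge> 0" and ac: "a * c = 0" and bd: "b * d = 0"
        by (auto simp: a_b_c_d_def f_def h_def max_def)
      have "(a - b)\<^sup>2 + (c - d)\<^sup>2 \<le> (a - b)\<^sup>2 + (c - d)\<^sup>2 + 2 * (a * d) + 2 * (b * c)"
        using nn by simp
      also have "\<dots> = ((a - b) - (c - d))\<^sup>2 + 2 * (a * c) + 2 * (b * d)"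
        by (simp add: power2_eq_square algebra_simps)
      also have "(a - b) - (c - d) = g (fst e) - g (snd e)"
        by (auto simp: a_b_c_d_def f_def h_def max_def)
      finally show "(f (fst e) - f (snd e))\<^sup>2 + (h (fst e) - h (snd e))\<^sup>2 \<le> (g (fst e) - g (snd e))\<^sup>2"
        unfolding ac bd by (simp flip: a_b_c_d_def)
    qed
    finally show ?thesis .
  qed
  finally show ?thesis
    using \<gamma>_less_1 by (simp add: ennreal_leI mult_left_mono)
qed

lemma energy_lower_bound:
  assumes bdd: "bounded (range g)" and nonneg: "\<And>x. g x \<ge> 0"
    and mean: "measure_pmf.expectation \<pi> g = 1"
    and V: "measure_pmf.expectation \<pi> (\<lambda>x. (g x)\<^sup>2) = 1 + V" "V > 0"
  shows "(conductance_profile P \<pi> (4 / V))\<^sup>2 * ennreal (V / 2) \<le> ennreal ((1 - \<gamma>) * energy g)"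
proof (cases "4 / V \<le> 1/2")
  case True
  with assms show ?thesis by (intro energy_lower_bound_truncation)
next
  case False
  then have "conductance_profile P \<pi> (4 / V) = conductance_profile P \<pi> (1/2)"
    by (simp add: conductance_profile_def)
  moreover have "(conductance_profile P \<pi> (1/2))\<^sup>2 * ennreal (V / 2)
      \<le> (conductance_profile P \<pi> (1/2))\<^sup>2 * ennreal V"
    using V by (intro mult_left_mono ennreal_leI) auto
  ultimately show ?thesis
    using energy_lower_bound_median[OF bdd mean V(1)] V(2) by (auto intro: order_trans)
qed

end

section \<open>Decay of the chi-square distance\<close>

lemma nstep_0_eq: "nstep P 0 = return_pmf"
  by (rule ext) simp

lemma nstep_Suc_eq: "nstep P (Suc n) = (\<lambda>x. bind_pmf (P x) (nstep P n))"
  by (rule ext) simp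

lemma nstep_1_eq: "nstep P (Suc 0) = P"
  unfolding nstep_Suc_eq nstep_0_eq by (simp add: bind_return_pmf')

lemma nstep_add: "nstep P (m + n) x = bind_pmf (nstep P m x) (nstep P n)"
proof (induction m arbitrary: x)
  case (Suc m)
  then have "nstep P (m + n) = (\<lambda>x. bind_pmf (nstep P m x) (nstep P n))" by (rule ext)
  then show ?case by (simp add: bind_assoc_pmf)
qed (simp add: bind_return_pmf)

lemma invariant_nstep:
  assumes "bind_pmf \<pi> P = \<pi>"
  shows "bind_pmf \<pi> (nstep P n) = \<pi>"
proof (induction n)
  case 0
  show ?case by (simp only: nstep_0_eq bind_return_pmf')
next
  case (Suc n)
  show ?case by (simp only: nstep_Suc_eq bind_assoc_pmf[symmetric] assms Suc)
qed

context lazy_chain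
begin

definition transition_density :: "'a \<Rightarrow> nat \<Rightarrow> 'a \<Rightarrow> real" where
  "transition_density z n y = pmf (nstep P n y) z / pmf \<pi> z"

text \<open>
  This is the chi-square distance to \<open>\<pi>\<close> of the time-reversed chain after \<open>n\<close> steps from \<open>z\<close>.
\<close>

definition chi_square :: "'a \<Rightarrow> nat \<Rightarrow> real" where
  "chi_square z n = measure_pmf.expectation \<pi> (\<lambda>y. (transition_density z n y - 1)\<^sup>2)"

lemma density_nonneg: "transition_density z n y \<ge> 0"
  by (simp add: transition_density_def)

lemma bounded_density: "bounded (range (transition_density z n))"
  by (rule bounded_rangeI[of _ "1 / pmf \<pi> z"])
     (auto simp: transition_density_def pmf_le_1 intro!: divide_right_mono)

lemma transfer_density: "transfer (transition_density z n) y = transition_density z (Suc n) y"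
  by (simp add: transition_density_def[abs_def] pmf_bind)

lemma expectation_density:
  assumes "pmf \<pi> z > 0"
  shows "measure_pmf.expectation \<pi> (transition_density z n) = 1"
proof -
  have "measure_pmf.expectation \<pi> (transition_density z n) = pmf (bind_pmf \<pi> (nstep P n)) z / pmf \<pi> z"
    by (simp add: transition_density_def[abs_def] pmf_bind)
  with assms show ?thesis by (simp add: invariant_nstep[OF invariant])
qed

lemma expectation_density_square:
  assumes "pmf \<pi> z > 0"
  shows "measure_pmf.expectation \<pi> (\<lambda>y. (transition_density z n y)\<^sup>2) = 1 + chi_square z n"
proof -
  have "chi_square z n = measure_pmf.expectation \<pi> (\<lambda>y. (transition_density z n y)\<^sup>2 - 2 * transition_density z n y + 1)"
    unfolding chi_square_def
    by (intro Bochner_Integration.integral_cong) (auto simp: power2_eq_square algebra_simps)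
  also have "\<dots> = measure_pmf.expectation \<pi> (\<lambda>y. (transition_density z n y)\<^sup>2) - 2 * 1 + 1"
    by (subst Bochner_Integration.integral_add Bochner_Integration.integral_diff;
        (intro integrable_intros bounded_density)?)+ (simp add: expectation_density[OF assms])
  finally show ?thesis by simp
qed

lemma chi_square_0:
  assumes "pmf \<pi> z > 0"
  shows "chi_square z 0 = 1 / pmf \<pi> z - 1"
proof -
  have "measure_pmf.expectation \<pi> (\<lambda>y. (transition_density z 0 y)\<^sup>2)
      = measure_pmf.expectation \<pi> (\<lambda>y. indicator {z} y / (pmf \<pi> z)\<^sup>2)"
    by (intro Bochner_Integration.integral_cong) (auto simp: transition_density_def power_divide indicator_def)
  also have "\<dots> = 1 / pmf \<pi> z"
    using assms by (simp add: measure_pmf_single power2_eq_square)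
  finally show ?thesis
    using expectation_density_square[OF assms, of 0] by simp
qed

lemma chi_square_Suc_le:
  assumes "pmf \<pi> z > 0"
  shows "chi_square z (Suc n) + \<gamma> * energy (transition_density z n) \<le> chi_square z n"
  using variance_decay[OF bounded_density, of z n] expectation_density_square[OF assms]
  by (simp add: transfer_density)

text \<open>
  That the profile is finite at \<open>4/V\<^sub>n\<close> is part of the conclusion: it follows from the energy bound, because a
  positive variance times an infinite profile could not be bounded by a finite energy.
\<close>

lemma chi_square_step:
  assumes z: "pmf \<pi> z > 0" and V: "chi_square z n > 0"
  shows "\<exists>t\<ge>0. conductance_profile P \<pi> (4 / chi_square z n) = ennreal t
    \<and> chi_square z (Suc n) \<le> chi_square z n * (1 - \<gamma> / (2 * (1 - \<gamma>)) * t\<^sup>2)"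
proof -
  define V where "V = chi_square z n"
  define \<phi> where "\<phi> = conductance_profile P \<pi> (4 / V)"
  have "V > 0" using assms by (simp add: V_def)
  have bound: "\<phi>\<^sup>2 * ennreal (V / 2) \<le> ennreal ((1 - \<gamma>) * energy (transition_density z n))"
    unfolding \<phi>_def
    using expectation_density[OF z] expectation_density_square[OF z] assms(2)
    by (intro energy_lower_bound bounded_density density_nonneg) (auto simp: V_def)
  then have "\<phi> \<noteq> top"
    using \<open>V > 0\<close> by (auto simp: ennreal_top_mult top_unique power2_eq_square)
  then obtain t where t: "t \<ge> 0" "\<phi> = ennreal t"
    by (cases \<phi>) auto
  have "t\<^sup>2 * (V / 2) \<le> (1 - \<gamma>) * energy (transition_density z n)"
    using bound t \<open>V > 0\<close> \<gamma>_less_1 energy_nonneg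
    by (subst (asm) t, subst (asm) ennreal_power, simp, subst (asm) ennreal_mult[symmetric])
       (auto simp: mult_nonneg_nonneg)
  then have "\<gamma> / (1 - \<gamma>) * (t\<^sup>2 * (V / 2)) \<le> \<gamma> / (1 - \<gamma>) * ((1 - \<gamma>) * energy (transition_density z n))"
    using \<gamma>_pos \<gamma>_less_1 by (intro mult_left_mono) auto
  also have "\<dots> = \<gamma> * energy (transition_density z n)"
    using \<gamma>_less_1 by simp
  also have "\<dots> \<le> V - chi_square z (Suc n)"
    using chi_square_Suc_le[OF z, of n] by (simp add: V_def)
  finally have "chi_square z (Suc n) \<le> V * (1 - \<gamma> / (2 * (1 - \<gamma>)) * t\<^sup>2)"
    by (simp add: algebra_simps)
  with t show ?thesis unfolding \<phi>_def V_def by blast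
qed

end

section \<open>From the recursion to the integral\<close>

lemma ennreal_inverse_antimono:
  fixes b c :: ennreal
  assumes "b \<le> c"
  shows "inverse c \<le> inverse b"
proof (cases "b = 0 \<or> c = top")
  case False
  with assms have "b \<noteq> top" by (auto simp: top_unique)
  then obtain r where r: "b = ennreal r" "r > 0"
    using False by (cases b) (auto simp: less_le)
  obtain s where s: "c = ennreal s" "s \<ge> 0"
    using False by (cases c) auto
  with r assms have "r \<le> s" by simp
  with r s show ?thesis
    by (auto simp: inverse_ennreal intro!: ennreal_leI le_imp_inverse_le)
qed auto

lemma ennreal_divide_antimono:
  fixes a b c :: ennreal
  shows "b \<le> c \<Longrightarrow> a / c \<le> a / b"
  unfolding divide_ennreal_def by (intro mult_left_mono ennreal_inverse_antimono) auto

text \<open>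
  The step function with value \<open>c i\<close> on \<open>A i\<close> is a measurable minorant of \<open>f\<close> on \<open>S\<close>. Only its integral is split
  into pieces, so that nothing has to be known about the regularity of the conductance profile.
\<close>

lemma nn_integral_ge_sum_disjoint:
  fixes f :: "'b \<Rightarrow> ennreal"
  assumes fin: "finite I" and disj: "disjoint_family_on A I"
    and meas: "\<And>i. i \<in> I \<Longrightarrow> A i \<in> sets M" and sub: "\<And>i. i \<in> I \<Longrightarrow> A i \<subseteq> S"
    and le: "\<And>i u. i \<in> I \<Longrightarrow> u \<in> A i \<Longrightarrow> c i \<le> f u"
  shows "(\<Sum>i\<in>I. c i * emeasure M (A i)) \<le> (\<integral>\<^sup>+u\<in>S. f u \<partial>M)"
proof -
  have "(\<Sum>i\<in>I. c i * emeasure M (A i)) = (\<integral>\<^sup>+u. (\<Sum>i\<in>I. c i * indicator (A i) u) \<partial>M)"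
    using meas by (subst nn_integral_sum) (auto simp: nn_integral_cmult_indicator)
  also have "\<dots> \<le> (\<integral>\<^sup>+u\<in>S. f u \<partial>M)"
  proof (intro nn_integral_mono)
    fix u
    show "(\<Sum>i\<in>I. c i * indicator (A i) u) \<le> f u * indicator S u"
    proof (cases "\<exists>i\<in>I. u \<in> A i")
      case True
      then obtain i where i: "i \<in> I" "u \<in> A i" by blast
      have "(\<Sum>j\<in>I. c j * indicator (A j) u) = (\<Sum>j\<in>I. if j = i then c i else 0)"
        using disj i by (intro sum.cong) (auto simp: disjoint_family_on_def indicator_def)
      also have "\<dots> = c i" using fin i by simp
      also have "\<dots> \<le> f u * indicator S u" using le[OF i] sub[OF i(1)] i(2) by (auto simp: indicator_def)
      finally show ?thesis .
    next
      case False
      then have "(\<Sum>i\<in>I. c i * indicator (A i) u) = 0" by (intro sum.neutral) auto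
      then show ?thesis by simp
    qed
  qed
  finally show ?thesis .
qed

text \<open>
  The points \<open>4/V\<^sub>k\<close> increase with \<open>k\<close>. On \<open>[4/V\<^sub>k, 4/V\<^sub>k\<^sub>+\<^sub>1)\<close> the integrand is at least
  \<open>V\<^sub>k\<^sub>+\<^sub>1/\<phi>(4/V\<^sub>k)\<^sup>2\<close>, so the interval contributes at least
  \<open>4 (1 - V\<^sub>k\<^sub>+\<^sub>1/V\<^sub>k)/\<phi>(4/V\<^sub>k)\<^sup>2 \<ge> 4\<kappa>\<close>. If \<open>V\<^sub>m > \<epsilon>\<close> held, the first \<open>m\<close> intervals would use up the
  whole allowance \<open>4\<kappa>m\<close>, while \<open>[4/V\<^sub>m, 4/\<epsilon>)\<close> still contributes a positive amount.
\<close>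

lemma decay_by_integral:
  fixes V :: "nat \<Rightarrow> real" and \<phi> :: "real \<Rightarrow> ennreal" and a \<epsilon> \<kappa> :: real
  assumes anti: "\<And>r s. r \<le> s \<Longrightarrow> \<phi> s \<le> \<phi> r"
    and pos: "a > 0" "\<epsilon> > 0" "\<kappa> > 0"
    and init: "V 0 > 0 \<Longrightarrow> a \<le> 4 / V 0"
    and step: "\<And>n. V n > 0 \<Longrightarrow> \<exists>t\<ge>0. \<phi> (4 / V n) = ennreal t \<and> V (Suc n) \<le> V n * (1 - \<kappa> * t\<^sup>2)"
    and dec: "\<And>n. V (Suc n) \<le> V n"
    and int: "(\<integral>\<^sup>+u\<in>{a..4 / \<epsilon>}. 4 / (ennreal u * (\<phi> u)\<^sup>2) \<partial>lborel) \<le> ennreal (4 * \<kappa> * m)"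
  shows "V m \<le> \<epsilon>"
proof (rule ccontr)
  assume "\<not> V m \<le> \<epsilon>"
  then have Vm: "V m > \<epsilon>" by simp
  have Vpos: "V k > 0" if "k \<le> m" for k
    using lift_Suc_antimono_le[of V, OF dec that] Vm pos by simp
  \<comment> \<open>The interval that remains after \<open>m\<close> steps becomes one more piece, ending at \<open>\<alpha> (Suc m) = 4/\<epsilon>\<close>.\<close>
  define \<alpha> where "\<alpha> k = (if k \<le> m then 4 / V k else 4 / \<epsilon>)" for k
  have \<alpha>_pos: "\<alpha> k > 0" for k
    using Vpos pos by (simp add: \<alpha>_def)
  have \<alpha>_Suc: "\<alpha> k \<le> \<alpha> (Suc k)" for k
  proof (cases "k < m")
    case True
    then show ?thesis using dec[of k] True Vpos[of k] Vpos[of "Suc k"]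
      by (simp add: \<alpha>_def field_simps)
  next
    case False
    then show ?thesis using Vm pos by (auto simp: \<alpha>_def frac_le)
  qed
  have \<alpha>_mono: "\<alpha> j \<le> \<alpha> k" if "j \<le> k" for j k
    using that \<alpha>_Suc by (rule lift_Suc_mono_le[rotated])
  have last: "\<alpha> m < \<alpha> (Suc m)"
    using Vm pos by (simp add: \<alpha>_def frac_less2)
  have "a \<le> \<alpha> 0" using init Vpos[of 0] by (simp add: \<alpha>_def)
  define A where "A k = {\<alpha> k..<\<alpha> (Suc k)}" for k
  define c where "c k = 4 / (ennreal (\<alpha> (Suc k)) * (\<phi> (\<alpha> k))\<^sup>2)" for k
  have disj: "disjoint_family_on A {..m}"
  proof -
    have "A i \<inter> A j = {}" if "i < j" for i j
      using \<alpha>_mono[of "Suc i" j] that by (auto simp: A_def)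
    then show ?thesis
      unfolding disjoint_family_on_def by (metis inf_commute linorder_neqE_nat)
  qed
  have le: "c k \<le> 4 / (ennreal u * (\<phi> u)\<^sup>2)" if "u \<in> A k" for k u
    unfolding c_def using that anti
    by (intro ennreal_divide_antimono mult_mono power_mono ennreal_leI) (auto simp: A_def)
  have sub: "A k \<subseteq> {a..4 / \<epsilon>}" if "k \<in> {..m}" for k
    using \<alpha>_mono[of 0 k] \<alpha>_mono[of "Suc k" "Suc m"] that \<open>a \<le> \<alpha> 0\<close>
    by (auto simp: A_def \<alpha>_def[of "Suc m"])
  have "(\<Sum>k\<le>m. c k * emeasure lborel (A k)) \<le> ennreal (4 * \<kappa> * m)"
    by (rule order_trans[OF nn_integral_ge_sum_disjoint int]) (auto simp: disj le sub, simp add: A_def)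
  moreover have "(\<Sum>k\<le>m. c k * emeasure lborel (A k))
      = (\<Sum>k<m. c k * emeasure lborel (A k)) + c m * emeasure lborel (A m)"
    by (simp flip: lessThan_Suc_atMost)
  ultimately have total: "(\<Sum>k<m. c k * emeasure lborel (A k)) + c m * emeasure lborel (A m) \<le> ennreal (4 * \<kappa> * m)"
    by simp
  have emA: "emeasure lborel (A k) = ennreal (\<alpha> (Suc k) - \<alpha> k)" for k
    using \<alpha>_Suc by (simp add: A_def)
  have t_ex: "\<exists>t\<ge>0. \<phi> (\<alpha> k) = ennreal t \<and> V (Suc k) \<le> V k * (1 - \<kappa> * t\<^sup>2)" if "k \<le> m" for k
    using step[OF Vpos[OF that]] that by (simp add: \<alpha>_def)
  then obtain t where t: "\<And>k. k \<le> m \<Longrightarrow> t k \<ge> 0" "\<And>k. k \<le> m \<Longrightarrow> \<phi> (\<alpha> k) = ennreal (t k)"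
      "\<And>k. k \<le> m \<Longrightarrow> V (Suc k) \<le> V k * (1 - \<kappa> * (t k)\<^sup>2)"
    by metis
  show False
  \<comment> \<open>A profile that vanishes at \<open>4/V\<^sub>m\<close> makes the integral over the last interval infinite.\<close>
  proof (cases "t m = 0")
    case True
    then have "c m = top"
      using t(2)[of m] by (simp add: c_def ennreal_divide_zero)
    then have "c m * emeasure lborel (A m) = top"
      using last by (simp add: emA ennreal_top_mult)
    with total show False by (simp add: top_unique)
  next
    case False
    with t(1)[of m] have "t m > 0" by simp
    have tpos: "t k > 0" if "k \<le> m" for k
    proof -
      have "ennreal (t m) \<le> ennreal (t k)"
        using anti[OF \<alpha>_mono[OF that]] t(2)[OF that] t(2)[of m] by simp
      then show ?thesis using \<open>t m > 0\<close> t(1)[OF that] by simp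
    qed
    have ck: "c k = ennreal (4 / (\<alpha> (Suc k) * (t k)\<^sup>2))" if "k \<le> m" for k
    proof -
      have "c k = ennreal 4 / ennreal (\<alpha> (Suc k) * (t k)\<^sup>2)"
        using t(1,2)[OF that] \<alpha>_pos[of "Suc k"]
        by (simp add: c_def ennreal_power ennreal_mult less_imp_le)
      also have "\<dots> = ennreal (4 / (\<alpha> (Suc k) * (t k)\<^sup>2))"
        using tpos[OF that] \<alpha>_pos[of "Suc k"] by (intro divide_ennreal) auto
      finally show ?thesis .
    qed
    have piece: "c k * emeasure lborel (A k) = ennreal (4 / (\<alpha> (Suc k) * (t k)\<^sup>2) * (\<alpha> (Suc k) - \<alpha> k))"
      if "k \<le> m" for k
      unfolding ck[OF that] emA using \<alpha>_pos[of "Suc k"] \<alpha>_Suc[of k]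
      by (intro ennreal_mult[symmetric]) (auto simp: less_imp_le)
    have "4 * \<kappa> \<le> 4 / (\<alpha> (Suc k) * (t k)\<^sup>2) * (\<alpha> (Suc k) - \<alpha> k)" if "k < m" for k
    proof -
      have \<alpha>: "\<alpha> k = 4 / V k" "\<alpha> (Suc k) = 4 / V (Suc k)"
        using that by (auto simp: \<alpha>_def)
      have V: "V k > 0" "V (Suc k) > 0" using that Vpos[of k] Vpos[of "Suc k"] by auto
      have "\<kappa> * (t k)\<^sup>2 \<le> 1 - V (Suc k) / V k"
        using t(3)[of k] that V by (simp add: field_simps)
      also have "\<dots> = (\<alpha> (Suc k) - \<alpha> k) / \<alpha> (Suc k)"
        unfolding \<alpha> using V by (simp add: field_simps)
      finally show ?thesis
        using tpos[of k] that \<alpha>_pos[of "Suc k"] by (simp add: field_simps)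
    qed
    then have "(\<Sum>k<m. ennreal (4 * \<kappa>)) \<le> (\<Sum>k<m. c k * emeasure lborel (A k))"
      by (intro sum_mono) (auto simp: piece intro!: ennreal_leI)
    moreover have "(\<Sum>k<m. ennreal (4 * \<kappa>)) = ennreal (4 * \<kappa> * m)"
      using pos by (simp add: ennreal_mult ennreal_of_nat_eq_real_of_nat mult.commute)
    ultimately have "ennreal (4 * \<kappa> * m) \<le> (\<Sum>k<m. c k * emeasure lborel (A k))"
      by simp
    from order_trans[OF add_right_mono[OF this] total]
    have "ennreal (4 * \<kappa> * m) + c m * emeasure lborel (A m) \<le> ennreal (4 * \<kappa> * m) + 0"
      by simp
    then have "c m * emeasure lborel (A m) \<le> 0"
      unfolding ennreal_add_left_cancel_le by simp
    moreover have "c m * emeasure lborel (A m) > 0"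
      using last tpos[of m] \<alpha>_pos[of "Suc m"] by (simp add: piece)
    ultimately show False using leD by blast
  qed
qed

section \<open>Time reversal\<close>

lemma expectation_change_of_measure:
  fixes g :: "'b \<Rightarrow> real"
  assumes "\<And>w. pmf p w > 0"
  shows "measure_pmf.expectation p (\<lambda>w. pmf q w / pmf p w * g w) = measure_pmf.expectation q g"
  using assms[THEN less_imp_neq]
  by (simp add: measure_pmf_eq_density integral_density)

text \<open>
  The weights \<open>\<pi>(x) p(x,y)/\<pi>(y)\<close> sum to one over \<open>x\<close> exactly by stationarity.
\<close>

definition reverse_kernel :: "('a \<Rightarrow> 'a pmf) \<Rightarrow> 'a pmf \<Rightarrow> 'a \<Rightarrow> 'a pmf" where
  "reverse_kernel P \<pi> y = embed_pmf (\<lambda>x. pmf \<pi> x * pmf (P x) y / pmf \<pi> y)"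

locale lazy_chain_full_support = lazy_chain +
  assumes full_support: "\<And>x. pmf \<pi> x > 0"
begin

abbreviation R :: "'a \<Rightarrow> 'a pmf" where
  "R \<equiv> reverse_kernel P \<pi>"

lemma pmf_reverse: "pmf (R y) x = pmf \<pi> x * pmf (P x) y / pmf \<pi> y"
proof -
  have "(\<integral>\<^sup>+x. ennreal (pmf \<pi> x * pmf (P x) y / pmf \<pi> y) \<partial>count_space UNIV)
      = (\<integral>\<^sup>+x. ennreal (1 / pmf \<pi> y) * (ennreal (pmf \<pi> x) * ennreal (pmf (P x) y)) \<partial>count_space UNIV)"
    by (intro nn_integral_cong) (simp flip: ennreal_mult)
  also have "\<dots> = ennreal (1 / pmf \<pi> y) * ennreal (pmf (bind_pmf \<pi> P) y)"
    by (simp add: nn_integral_cmult ennreal_pmf_bind nn_integral_measure_pmf)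
  also have "\<dots> = 1"
    using full_support[of y] by (simp add: invariant flip: ennreal_mult)
  finally show ?thesis
    unfolding reverse_kernel_def by (subst pmf_embed_pmf) auto
qed

lemma detailed_reversal: "pmf \<pi> y * pmf (R y) x = pmf \<pi> x * pmf (P x) y"
  using full_support[of y] by (simp add: pmf_reverse)

lemma edge_reverse: "edge_pmf R \<pi> = map_pmf prod.swap edge"
proof (rule pmf_eqI)
  fix e :: "'a \<times> 'a"
  obtain x y where e: "e = (x, y)" by (cases e)
  have "pmf (map_pmf prod.swap edge) (prod.swap (y, x)) = pmf edge (y, x)"
    by (rule pmf_map_inj') (simp add: inj_swap)
  then show "pmf (edge_pmf R \<pi>) e = pmf (map_pmf prod.swap edge) e"
    by (simp add: e pmf_edge detailed_reversal)
qed

lemma invariant_reverse: "bind_pmf \<pi> R = \<pi>"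
  using map_fst_edge[of P \<pi>]
  by (simp flip: map_snd_edge add: edge_reverse pmf.map_comp o_def)

lemma lazy_chain_reverse: "lazy_chain_full_support R \<pi> \<gamma>"
proof
  show "pmf (R z) z \<ge> \<gamma>" for z
    using holding[of z] full_support[of z] by (simp add: pmf_reverse)
qed (use invariant_reverse \<gamma>_pos \<gamma>_less_1 full_support in auto)

text \<open>
  Reversal turns the flow out of \<open>S\<close> into the flow into \<open>S\<close>. In equilibrium these agree, since both marginals of
  the edge law give \<open>S\<close> the measure \<open>\<pi>(S)\<close>.
\<close>

lemma flow_reverse: "flow R \<pi> S (- S) = flow P \<pi> S (- S)"
proof -
  have "measure_pmf.prob edge (S \<times> UNIV) = measure_pmf.prob \<pi> S"
    using measure_map_pmf[of fst edge S] by (simp add: map_fst_edge vimage_fst)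
  moreover have "measure_pmf.prob edge (UNIV \<times> S) = measure_pmf.prob \<pi> S"
    using measure_map_pmf[of snd edge S] by (simp add: map_snd_edge invariant vimage_snd)
  moreover have "S \<times> UNIV = S \<times> S \<union> S \<times> - S" "UNIV \<times> S = S \<times> S \<union> (- S) \<times> S"
    by auto
  moreover have "measure_pmf.prob edge (S \<times> S \<union> S \<times> - S)
      = measure_pmf.prob edge (S \<times> S) + measure_pmf.prob edge (S \<times> - S)"
    by (rule measure_pmf.finite_measure_Union) auto
  moreover have "measure_pmf.prob edge (S \<times> S \<union> (- S) \<times> S)
      = measure_pmf.prob edge (S \<times> S) + measure_pmf.prob edge ((- S) \<times> S)"
    by (rule measure_pmf.finite_measure_Union) auto
  moreover have "prod.swap -` (S \<times> - S) = (- S) \<times> S"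
    by auto
  ultimately show ?thesis
    by (simp add: flow_eq_prob_edge edge_reverse)
qed

lemma conductance_profile_reverse: "conductance_profile R \<pi> = conductance_profile P \<pi>"
  by (simp add: conductance_profile_def[abs_def] conductance_def flow_reverse)

lemma nstep_reverse: "pmf \<pi> y * pmf (nstep R n y) x = pmf \<pi> x * pmf (nstep P n x) y"
proof (induction n arbitrary: x)
  case 0
  show ?case by (auto simp: indicator_def)
next
  case (Suc n)
  have Rx: "pmf (R w) x / pmf \<pi> x = pmf (P x) w / pmf \<pi> w" for w
    using full_support[of w] full_support[of x] by (simp add: pmf_reverse)
  have "pmf \<pi> y * pmf (nstep R (n + 1) y) x
      = pmf \<pi> y * measure_pmf.expectation (nstep R n y) (\<lambda>w. pmf (R w) x)"
    unfolding nstep_add by (simp only: One_nat_def nstep_1_eq pmf_bind)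
  also have "\<dots> = measure_pmf.expectation \<pi> (\<lambda>w. pmf \<pi> y * (pmf (nstep R n y) w / pmf \<pi> w * pmf (R w) x))"
    by (simp only: integral_mult_right_zero expectation_change_of_measure[OF full_support])
  also have "\<dots> = measure_pmf.expectation \<pi> (\<lambda>w. pmf \<pi> x * (pmf (P x) w / pmf \<pi> w * pmf (nstep P n w) y))"
  proof (intro Bochner_Integration.integral_cong refl)
    fix w
    have "pmf \<pi> y * (pmf (nstep R n y) w / pmf \<pi> w * pmf (R w) x)
        = pmf (nstep P n w) y * pmf (R w) x"
      using Suc[of w] full_support[of w] by (simp add: field_simps)
    also have "\<dots> = pmf \<pi> x * (pmf (R w) x / pmf \<pi> x) * pmf (nstep P n w) y"
      using full_support[of x] by simp
    finally show "pmf \<pi> y * (pmf (nstep R n y) w / pmf \<pi> w * pmf (R w) x)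
        = pmf \<pi> x * (pmf (P x) w / pmf \<pi> w * pmf (nstep P n w) y)"
      by (simp only: Rx mult.assoc)
  qed
  also have "\<dots> = pmf \<pi> x * pmf (nstep P (Suc n) x) y"
    by (simp only: integral_mult_right_zero expectation_change_of_measure[OF full_support] nstep_Suc_eq pmf_bind)
  finally show ?case by simp
qed

text \<open>
  At time \<open>0\<close> the chi-square distance is \<open>1/\<pi>(z) - 1\<close>, which is where the lower limit of integration
  \<open>4 \<pi>(z)\<close> comes from.
\<close>

lemma chi_square_le:
  assumes "\<epsilon> > 0" and a: "0 < a" "a \<le> 4 * pmf \<pi> z"
    and int: "(\<integral>\<^sup>+u\<in>{a..4 / \<epsilon>}. 4 / (ennreal u * (conductance_profile P \<pi> u)\<^sup>2) \<partial>lborel)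
      \<le> ennreal (2 * \<gamma> / (1 - \<gamma>) * m)"
  shows "chi_square z m \<le> \<epsilon>"
proof (rule decay_by_integral[where \<phi> = "conductance_profile P \<pi>" and a = a and \<kappa> = "\<gamma> / (2 * (1 - \<gamma>))"])
  show "a \<le> 4 / chi_square z 0" if "chi_square z 0 > 0"
  proof -
    have "a * chi_square z 0 \<le> 4 * pmf \<pi> z * (1 / pmf \<pi> z - 1)"
      using a that by (subst chi_square_0[OF full_support, symmetric]) (intro mult_right_mono, auto)
    also have "\<dots> \<le> 4" using full_support[of z] by (simp add: algebra_simps)
    finally show ?thesis using that by (simp add: field_simps)
  qed
  have "4 * (\<gamma> / (2 * (1 - \<gamma>))) * real m = 2 * \<gamma> / (1 - \<gamma>) * m"
    using \<gamma>_less_1 by (simp add: field_simps)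
  with int show "(\<integral>\<^sup>+u\<in>{a..4 / \<epsilon>}. 4 / (ennreal u * (conductance_profile P \<pi> u)\<^sup>2) \<partial>lborel)
      \<le> ennreal (4 * (\<gamma> / (2 * (1 - \<gamma>))) * real m)"
    by simp
  show "chi_square z (Suc n) \<le> chi_square z n" for n
    using chi_square_Suc_le[OF full_support, of z n] \<gamma>_pos energy_nonneg
    by (smt (verit) mult_nonneg_nonneg)
  show "\<exists>t\<ge>0. conductance_profile P \<pi> (4 / chi_square z n) = ennreal t
      \<and> chi_square z (Suc n) \<le> chi_square z n * (1 - \<gamma> / (2 * (1 - \<gamma>)) * t\<^sup>2)"
    if "chi_square z n > 0" for n
    using full_support that by (rule chi_square_step)
qed (use assms \<gamma>_pos \<gamma>_less_1 in \<open>auto intro: profile_antimono\<close>)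

text \<open>
  With \<open>h = p\<^sup>m(x,\<cdot>)/\<pi>\<close>, which is also the density of the reversed chain into \<open>x\<close>, and
  \<open>g = p\<^sup>n(\<cdot>,y)/\<pi>(y)\<close>, the Chapman-Kolmogorov equation reads \<open>p\<^sup>m\<^sup>+\<^sup>n(x,y)/\<pi>(y) = \<langle>h, g\<rangle>\<close>. Both functions have
  mean \<open>1\<close>, so subtracting \<open>1\<close> from each subtracts \<open>1\<close> from the inner product, and Cauchy-Schwarz applies.
\<close>

lemma relative_error_le_chi_square:
  "(pmf (nstep P (m + n) x) y / pmf \<pi> y - 1)\<^sup>2
    \<le> lazy_chain.chi_square R \<pi> x m * chi_square y n"
proof -
  interpret rev: lazy_chain_full_support R \<pi> \<gamma> by (rule lazy_chain_reverse)
  define h g where "h = rev.transition_density x m" and "g = transition_density y n"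
  have bh: "bounded (range h)" and bg: "bounded (range g)"
    unfolding h_def g_def by (rule rev.bounded_density bounded_density)+
  have h: "h w = pmf (nstep P m x) w / pmf \<pi> w" for w
    using nstep_reverse[of w m x] full_support[of x] full_support[of w]
    by (simp add: h_def rev.transition_density_def field_simps)
  have "measure_pmf.expectation \<pi> (\<lambda>w. h w * g w) = measure_pmf.expectation (nstep P m x) g"
    unfolding h by (rule expectation_change_of_measure[OF full_support])
  also have "\<dots> = pmf (nstep P (m + n) x) y / pmf \<pi> y"
    by (simp add: g_def transition_density_def[abs_def] nstep_add pmf_bind)
  finally have hg: "measure_pmf.expectation \<pi> (\<lambda>w. h w * g w) = pmf (nstep P (m + n) x) y / pmf \<pi> y" .
  have "measure_pmf.expectation \<pi> (\<lambda>w. (h w - 1) * (g w - 1))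
      = measure_pmf.expectation \<pi> (\<lambda>w. h w * g w - h w - g w + 1)"
    by (intro Bochner_Integration.integral_cong) (auto simp: algebra_simps)
  also have "\<dots> = pmf (nstep P (m + n) x) y / pmf \<pi> y - 1 - 1 + 1"
    using rev.expectation_density[OF full_support, of x m] expectation_density[OF full_support, of y n]
    by (subst Bochner_Integration.integral_add Bochner_Integration.integral_diff;
        (intro integrable_intros bh bg)?)+ (simp add: hg flip: h_def g_def)
  finally have "pmf (nstep P (m + n) x) y / pmf \<pi> y - 1
      = measure_pmf.expectation \<pi> (\<lambda>w. (h w - 1) * (g w - 1))"
    by simp
  then show ?thesis
    using pmf_Cauchy_Schwarz[of "\<lambda>w. h w - 1" "\<lambda>w. g w - 1" \<pi>] bounded_range_diff[OF bh bounded_range_const]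
      bounded_range_diff[OF bg bounded_range_const]
    by (simp add: rev.chi_square_def chi_square_def h_def g_def)
qed

end

section \<open>The mixing bound\<close>

lemma stationary_full_support:
  assumes "irreducible_chain P" and inv: "bind_pmf \<pi> P = \<pi>"
  shows "pmf \<pi> y > 0"
proof -
  obtain x where x: "x \<in> set_pmf \<pi>" using set_pmf_not_empty[of \<pi>] by blast
  obtain n where "pmf (nstep P n x) y > 0"
    using assms(1) unfolding irreducible_chain_def by blast
  then have "y \<in> set_pmf (bind_pmf \<pi> (nstep P n))"
    using x by (auto simp: set_pmf_iff intro!: bexI[of _ x])
  then show ?thesis by (simp add: invariant_nstep[OF inv] pmf_positive del: set_bind_pmf)
qed

theorem theorem5:
  fixes P :: "'a::countable \<Rightarrow> 'a pmf" and \<pi> :: "'a pmf"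
    and \<gamma> \<epsilon> :: real and x y :: 'a and n :: nat
  assumes "irreducible_chain P"
    and "stationary P \<pi>"
    and "0 < \<gamma>" and "\<gamma> \<le> 1/2"
    and "\<And>z. pmf (P z) z \<ge> \<gamma>"
    and "\<epsilon> > 0"
    and "ereal (real n) \<ge> 1 + ereal ((1 - \<gamma>)\<^sup>2 / \<gamma>\<^sup>2) *
           oriented_integral (4 * min (pmf \<pi> x) (pmf \<pi> y)) (4 / \<epsilon>)
             (\<lambda>u. 4 / (ennreal u * (conductance_profile P \<pi> u)\<^sup>2))"
  shows "\<bar>(pmf (nstep P n x) y - pmf \<pi> y) / pmf \<pi> y\<bar> \<le> \<epsilon>"
proof -
  have inv: "bind_pmf \<pi> P = \<pi>"
    using assms(2) by (simp add: stationary_iff_bind)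
  interpret lazy_chain_full_support P \<pi> \<gamma>
    by unfold_locales (use assms inv stationary_full_support[OF assms(1) inv] in auto)
  interpret rev: lazy_chain_full_support R \<pi> \<gamma>
    by (rule lazy_chain_reverse)
  define a where "a = 4 * min (pmf \<pi> x) (pmf \<pi> y)"
  have a: "0 < a" "a \<le> 4 * pmf \<pi> x" "a \<le> 4 * pmf \<pi> y"
    using full_support by (auto simp: a_def)
  have rel: "(pmf (nstep P n x) y - pmf \<pi> y) / pmf \<pi> y = pmf (nstep P n x) y / pmf \<pi> y - 1"
    using full_support[of y] by (simp add: field_simps)
  show ?thesis
  proof (cases "a \<le> 4 / \<epsilon>")
    case False
    \<comment> \<open>Reversed limits mean \<open>\<epsilon> > 1 / min (\<pi> x) (\<pi> y)\<close>, and the relative error never exceeds \<open>1 / \<pi> y\<close>.\<close>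
    have "\<bar>pmf (nstep P n x) y - pmf \<pi> y\<bar> \<le> 1"
      using pmf_le_1[of "nstep P n x" y] pmf_le_1[of \<pi> y] pmf_nonneg[of "nstep P n x" y]
        pmf_nonneg[of \<pi> y] by linarith
    also have "1 < \<epsilon> * (a / 4)"
      using False assms(6) by (simp add: field_simps)
    also have "\<dots> \<le> \<epsilon> * pmf \<pi> y"
      using a assms(6) by (intro mult_left_mono) auto
    finally show ?thesis
      using full_support[of y] by (simp add: abs_divide field_simps)
  next
    case True
    define I where "I = (\<integral>\<^sup>+u\<in>{a..4 / \<epsilon>}. 4 / (ennreal u * (conductance_profile P \<pi> u)\<^sup>2) \<partial>lborel)"
    define C where "C = (1 - \<gamma>)\<^sup>2 / \<gamma>\<^sup>2"
    have "C > 0" using \<gamma>_pos \<gamma>_less_1 by (simp add: C_def)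
    have hyp: "1 + ereal C * enn2ereal I \<le> ereal n"
      using assms(7) True by (simp add: oriented_integral_def a_def I_def C_def)
    then have "I \<noteq> top" using \<open>C > 0\<close> by auto
    then obtain i where i: "i \<ge> 0" "I = ennreal i" by (cases I) auto
    have Ci: "1 + C * i \<le> n"
      using hyp i by (simp add: one_ereal_def)
    have le: "I \<le> ennreal (2 * \<gamma> / (1 - \<gamma>) * m)" if "real n \<le> 2 * m + 1" for m :: nat
    proof -
      have "(1 - \<gamma>) / \<gamma> \<ge> 1" using assms(4) \<gamma>_pos by simp
      then have "(1 - \<gamma>) / \<gamma> * 1 \<le> (1 - \<gamma>) / \<gamma> * ((1 - \<gamma>) / \<gamma>)"
        by (intro mult_left_mono) auto
      then have "(1 - \<gamma>) / \<gamma> \<le> C" by (simp add: C_def power2_eq_square)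
      then have "(1 - \<gamma>) / \<gamma> * i \<le> C * i" using i by (intro mult_right_mono)
      also have "\<dots> \<le> 2 * m" using Ci that by simp
      finally have "i \<le> 2 * \<gamma> / (1 - \<gamma>) * m"
        using \<gamma>_pos \<gamma>_less_1 by (simp add: field_simps)
      then show ?thesis unfolding i(2) by (rule ennreal_leI)
    qed
    \<comment> \<open>Both halves satisfy \<open>k, l \<ge> (n - 1)/2\<close>; the summand 1 in the hypothesis pays for the rounding.\<close>
    define k l where "k = n div 2" and "l = n - n div 2"
    have kl: "k + l = n" "real n \<le> 2 * k + 1" "real n \<le> 2 * l + 1"
      unfolding k_def l_def by linarith+
    have "rev.chi_square x k \<le> \<epsilon>"
      using le[OF kl(2)] a assms(6) unfolding I_def
      by (intro rev.chi_square_le[of \<epsilon> a]) (auto simp: conductance_profile_reverse)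
    moreover have "chi_square y l \<le> \<epsilon>"
      using le[OF kl(3)] a assms(6) unfolding I_def by (intro chi_square_le[of \<epsilon> a]) auto
    ultimately have "rev.chi_square x k * chi_square y l \<le> \<epsilon> * \<epsilon>"
      using assms(6) by (intro mult_mono) (auto simp: chi_square_def)
    with relative_error_le_chi_square[of k l x y]
    have "(pmf (nstep P n x) y / pmf \<pi> y - 1)\<^sup>2 \<le> \<epsilon>\<^sup>2"
      by (simp add: kl power2_eq_square)
    then show ?thesis
      unfolding rel using assms(6) power2_le_iff_abs_le[of \<epsilon>] by simp
  qed
qed

end
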